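(* Let $G$ be a compact, connected Lie group acting on a manifold $M$, and let $E_\infty$ be the final page of the spectral sequence of the Cartan model. Let $x_1,\ldots,x_k\in E_\infty$ be homogeneous elements (with respect to the bigrading) that generate $E_\infty$ as an $S(\mathfrak g^* )^G$-module. Choose representatives $y_1,\ldots,y_k\in H^*_G(M)$ via the isomorphisms $E_\infty^{p,q}\cong F^pH^{p+q}_G(M)/F^{p+1}H^{p+q}_G(M)$ (i.e. if $x_i\in E_\infty^{p,q}$, then $y_i\in F^pH^{p+q}_G(M)$ projects to $x_i$). Then the $y_i$ generate $H^*_G(M)$ as an $S(\mathfrak g^* )^G$-module.
   Context: Manifolds and actions are smooth. $S(\mathfrak g^* )^G$ is the algebra of $\mathrm{Ad}$-invariant real polynomials on the Lie algebra $\mathfrak g$ of $G$. Cartan model: $C_G(M)=(S(\mathfrak g^* )\otimes\Omega(M))^G$, i.e. polynomial maps $\omega:\mathfrak g\to\Omega(M)$ with $\omega(\mathrm{Ad}_gX)=(g^{-1})^*(\omega(X))$, with differential $(d_G\omega)(X)=d(\omega(X))-i_{\overline X}(\omega(X))$, $\overline X_p=\frac{d}{dt}|_{t=0}\exp(tX)\cdot p$, graded by $C^n_G(M)=\bigoplus_{2k+l=n}(S^k(\mathfrak g^* )\otimes\Omega^l(M))^G$; $H^*_G(M)=H^*(C_G(M),d_G)$, an $S(\mathfrak g^* )^G$-algebra via $f\mapsto f\otimes1$. Spectral sequence: put $C^{2k,q}=(S^k(\mathfrak g^* )\otimes\Omega^q(M))^G$, $C^{l,q}=0$ for $l$ odd,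 and $F^pC_G(M)=\bigoplus_{l\ge p,\,q\ge0}C^{l,q}$. The associated first-quadrant spectral sequence has final page $E_\infty^{p,q}\cong F^pH^{p+q}_G(M)/F^{p+1}H^{p+q}_G(M)$, where $F^pH^n_G(M)=\mathrm{im}(H^n(F^pC_G(M))\to H^n_G(M))$. Its $S(\mathfrak g^* )^G$-module structure is induced by multiplication, $f\in S^k(\mathfrak g^* )^G$ mapping $F^pH^n_G/F^{p+1}H^n_G$ to $F^{p+2k}H^{n+2k}_G/F^{p+2k+1}H^{n+2k}_G$. *)

theory Defs
  imports
    "HOL-Analysis.Analysis"
    "HOL-Algebra.Group_Action"
    "HOL-Algebra.Module"
    "HOL-Library.Function_Algebras"
    "HOL-Library.Set_Algebras"
begin

section \<open>Smooth manifolds\<close>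

text \<open>
  An \<open>n\<close>-dimensional manifold is modelled on the library space \<^term>\<open>Euclidean_space n\<close> of
  sequences \<open>x :: nat \<Rightarrow> real\<close> with \<open>x i = 0\<close> for \<open>i \<ge> n\<close>; in this way dimension 0 is included.
  A function is of class \<open>C^k\<close> if its iterated partial derivatives up to order \<open>k\<close> exist
  and are continuous.
\<close>

primrec Ck_on :: "nat \<Rightarrow> nat \<Rightarrow> (nat \<Rightarrow> real) set \<Rightarrow> ((nat \<Rightarrow> real) \<Rightarrow> real) \<Rightarrow> bool" where
  "Ck_on n 0 U f \<longleftrightarrow> continuous_map (subtopology (Euclidean_space n) U) euclideanreal f"
| "Ck_on n (Suc k) U f \<longleftrightarrow>
     continuous_map (subtopology (Euclidean_space n) U) euclideanreal f \<and>
     (\<forall>i<n. (\<forall>x\<in>U. (\<lambda>t. f (x(i := t))) differentiable at (x i)) \<and>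
            Ck_on n k U (\<lambda>x. deriv (\<lambda>t. f (x(i := t))) (x i)))"

definition smooth_on :: "nat \<Rightarrow> (nat \<Rightarrow> real) set \<Rightarrow> ((nat \<Rightarrow> real) \<Rightarrow> real) \<Rightarrow> bool" where
  "smooth_on n U f \<longleftrightarrow> (\<forall>k. Ck_on n k U f)"

record 'a mfd =
  mtop :: "'a topology"
  mdim :: nat
  atlas :: "('a set \<times> ('a \<Rightarrow> nat \<Rightarrow> real)) set"

abbreviation pts :: "'a mfd \<Rightarrow> 'a set" where
  "pts M \<equiv> topspace (mtop M)"

definition smooth_map :: "'a mfd \<Rightarrow> 'b mfd \<Rightarrow> ('a \<Rightarrow> 'b) \<Rightarrow> bool" where
  "smooth_map M N F \<longleftrightarrow>
     continuous_map (mtop M) (mtop N) F \<and>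
     (\<forall>(U, \<phi>) \<in> atlas M. \<forall>(V, \<psi>) \<in> atlas N. \<forall>j < mdim N.
        smooth_on (mdim M) (\<phi> ` {p \<in> U. F p \<in> V}) (\<lambda>x. \<psi> (F (inv_into U \<phi> x)) j))"

text \<open>The second clause below is local Euclideanness, the last one (smoothness of the
  identity in all pairs of charts) is the smoothness of the transition maps.\<close>

definition smooth_manifold :: "'a mfd \<Rightarrow> bool" where
  "smooth_manifold M \<longleftrightarrow>
     Hausdorff_space (mtop M) \<and> second_countable (mtop M) \<and>
     (\<forall>(U, \<phi>) \<in> atlas M. openin (mtop M) U \<and>
        (\<exists>V. openin (Euclidean_space (mdim M)) V \<and>
             homeomorphic_map (subtopology (mtop M) U)
               (subtopology (Euclidean_space (mdim M)) V) \<phi>)) \<and>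
     (\<Union>(U, \<phi>) \<in> atlas M. U) = pts M \<and>
     smooth_map M M (\<lambda>p. p)"

definition prod_mfd :: "'a mfd \<Rightarrow> 'b mfd \<Rightarrow> ('a \<times> 'b) mfd" where
  "prod_mfd M N =
     \<lparr>mtop = prod_topology (mtop M) (mtop N), mdim = mdim M + mdim N,
      atlas = {(U \<times> V, \<lambda>(p, q) i. if i < mdim M then \<phi> p i else \<psi> q (i - mdim M)) | U V \<phi> \<psi>.
                 (U, \<phi>) \<in> atlas M \<and> (V, \<psi>) \<in> atlas N}\<rparr>"

definition real_mfd :: "real mfd" where
  "real_mfd = \<lparr>mtop = euclideanreal, mdim = 1,
               atlas = {(UNIV, \<lambda>t i. if i = 0 then t else 0)}\<rparr>"

text \<open>\<open>C^\<infinity>(M)\<close>. Here, and for tangent vectors, vector fields, forms and polynomials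
  below, functions are normalised to be 0 outside their domain, so that equality of HOL functions
  is equality of the mathematical objects. Sums and products of functions are pointwise
  (Function_Algebras).\<close>

definition Cinf :: "'a mfd \<Rightarrow> ('a \<Rightarrow> real) set" where
  "Cinf M = {f. (\<forall>p. p \<notin> pts M \<longrightarrow> f p = 0) \<and>
     (\<forall>(U, \<phi>) \<in> atlas M. smooth_on (mdim M) (\<phi> ` U) (\<lambda>x. f (inv_into U \<phi> x)))}"

definition fcomp :: "'a mfd \<Rightarrow> ('a \<Rightarrow> real) \<Rightarrow> ('a \<Rightarrow> 'a) \<Rightarrow> 'a \<Rightarrow> real" where
  "fcomp M f a = (\<lambda>p. if p \<in> pts M then f (a p) else 0)"


section \<open>Vector fields and differential forms\<close>

text \<open>
  Tangent vectors at \<open>p\<close> are point derivations of \<open>C^\<infinity>(M)\<close>, vector fields are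
  derivations of \<open>C^\<infinity>(M)\<close>, and \<open>q\<close>-forms are alternating \<open>C^\<infinity>(M)\<close>-multilinear maps from
  \<open>q\<close>-tuples of vector fields to \<open>C^\<infinity>(M)\<close> (the conventions of, e.g., Helgason's book).
\<close>

type_synonym 'a vec = "('a \<Rightarrow> real) \<Rightarrow> real"
type_synonym 'a vfield = "('a \<Rightarrow> real) \<Rightarrow> ('a \<Rightarrow> real)"
type_synonym 'a form = "'a vfield list \<Rightarrow> 'a \<Rightarrow> real"

definition tangent :: "'a mfd \<Rightarrow> 'a \<Rightarrow> 'a vec set" where
  "tangent M p = {v. (\<forall>f. f \<notin> Cinf M \<longrightarrow> v f = 0) \<and>
     (\<forall>f\<in>Cinf M. \<forall>g\<in>Cinf M. v (f + g) = v f + v g \<and> v (f * g) = f p * v g + g p * v f) \<and>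
     (\<forall>f\<in>Cinf M. \<forall>c. v (\<lambda>x. c * f x) = c * v f)}"

definition vfields :: "'a mfd \<Rightarrow> 'a vfield set" where
  "vfields M = {V. (\<forall>f. f \<notin> Cinf M \<longrightarrow> V f = 0) \<and> (\<forall>f\<in>Cinf M. V f \<in> Cinf M) \<and>
     (\<forall>f\<in>Cinf M. \<forall>g\<in>Cinf M. V (f + g) = V f + V g \<and> V (f * g) = f * V g + g * V f) \<and>
     (\<forall>f\<in>Cinf M. \<forall>c. V (\<lambda>x. c * f x) = (\<lambda>x. c * V f x))}"

definition lie_bracket :: "'a vfield \<Rightarrow> 'a vfield \<Rightarrow> 'a vfield" where
  "lie_bracket V W = (\<lambda>f. V (W f) - W (V f))"

definition forms :: "'a mfd \<Rightarrow> nat \<Rightarrow> 'a form set" where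
  "forms M q = {\<omega>.
     (\<forall>Vs. if length Vs = q \<and> set Vs \<subseteq> vfields M then \<omega> Vs \<in> Cinf M else \<omega> Vs = 0) \<and>
     (\<forall>Vs i V W. \<forall>f\<in>Cinf M. length Vs = q \<longrightarrow> set Vs \<subseteq> vfields M \<longrightarrow> i < q \<longrightarrow>
        V \<in> vfields M \<longrightarrow> W \<in> vfields M \<longrightarrow>
        \<omega> (Vs[i := (\<lambda>h. f * V h + W h)]) = f * \<omega> (Vs[i := V]) + \<omega> (Vs[i := W])) \<and>
     (\<forall>Vs i j. length Vs = q \<longrightarrow> set Vs \<subseteq> vfields M \<longrightarrow> i < j \<longrightarrow> j < q \<longrightarrow>
        Vs ! i = Vs ! j \<longrightarrow> \<omega> Vs = 0)}"

text \<open>An element of the type \<^typ>\<open>'a form\<close> that is nonzero on lists of several lengths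
  stands for an inhomogeneous form. The exterior derivative is given by
  \<open>d\<omega>(V\<^sub>0,\<dots>,V\<^sub>q) = \<Sum>\<^sub>i (-1)^i V\<^sub>i(\<omega>(\<dots>,no V\<^sub>i,\<dots>))
     + \<Sum>\<^sub>i\<^sub><\<^sub>j (-1)^(i+j) \<omega>([V\<^sub>i,V\<^sub>j],\<dots>,no V\<^sub>i,\<dots>,no V\<^sub>j,\<dots>)\<close>.\<close>

definition ext_deriv :: "'a mfd \<Rightarrow> 'a form \<Rightarrow> 'a form" where
  "ext_deriv M \<omega> Vs =
     (if Vs \<noteq> [] \<and> set Vs \<subseteq> vfields M then
        (\<Sum>i<length Vs. (- 1) ^ i * (Vs ! i) (\<omega> (nths Vs (- {i})))) +
        (\<Sum>j<length Vs. \<Sum>i<j.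
           (- 1) ^ (i + j) * \<omega> (lie_bracket (Vs ! i) (Vs ! j) # nths Vs (- {i, j})))
      else 0)"

definition contract :: "'a vfield \<Rightarrow> 'a form \<Rightarrow> 'a form" where
  "contract V \<omega> = (\<lambda>Vs. \<omega> (V # Vs))"

text \<open>Push-forward of vector fields and pull-back of forms along a diffeomorphism \<open>a\<close> of \<open>M\<close>:
  \<open>(a\<^sub>*V) f = V(f \<circ> a) \<circ> a\<^sup>-\<^sup>1\<close> and \<open>(a\<^sup>*\<omega>)(V\<^sub>1,\<dots>) = \<omega>(a\<^sub>*V\<^sub>1,\<dots>) \<circ> a\<close>.\<close>

definition push_vfield :: "'a mfd \<Rightarrow> ('a \<Rightarrow> 'a) \<Rightarrow> 'a vfield \<Rightarrow> 'a vfield" where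
  "push_vfield M a V =
     (\<lambda>f. if f \<in> Cinf M then fcomp M (V (fcomp M f a)) (inv_into (pts M) a) else 0)"

definition pull_form :: "'a mfd \<Rightarrow> ('a \<Rightarrow> 'a) \<Rightarrow> 'a form \<Rightarrow> 'a form" where
  "pull_form M a \<omega> =
     (\<lambda>Vs. if set Vs \<subseteq> vfields M then fcomp M (\<omega> (map (push_vfield M a) Vs)) a else 0)"


section \<open>Lie groups and smooth actions\<close>

record 'g lie_group = "'g monoid" +
  gmfd :: "'g mfd"

definition lie_group :: "'g lie_group \<Rightarrow> bool" where
  "lie_group G \<longleftrightarrow> group G \<and> smooth_manifold (gmfd G) \<and> pts (gmfd G) = carrier G \<and>
     smooth_map (prod_mfd (gmfd G) (gmfd G)) (gmfd G) (\<lambda>(g, h). g \<otimes>\<^bsub>G\<^esub> h) \<and>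
     smooth_map (gmfd G) (gmfd G) (\<lambda>g. inv\<^bsub>G\<^esub> g)"

definition smooth_action :: "'g lie_group \<Rightarrow> 'm mfd \<Rightarrow> ('g \<Rightarrow> 'm \<Rightarrow> 'm) \<Rightarrow> bool" where
  "smooth_action G M \<phi> \<longleftrightarrow> group_action G (pts M) \<phi> \<and>
     smooth_map (prod_mfd (gmfd G) M) M (\<lambda>(g, p). \<phi> g p)"

text \<open>The Lie algebra is the tangent space at the identity; only its vector space structure
  (pointwise operations), \<open>exp\<close> and \<open>Ad\<close> are needed.\<close>

definition lie_algebra :: "'g lie_group \<Rightarrow> 'g vec set" where
  "lie_algebra G = tangent (gmfd G) \<one>\<^bsub>G\<^esub>"

text \<open>\<open>exp X = \<gamma>(1)\<close> for the one-parameter subgroup \<open>\<gamma>\<close> with \<open>\<gamma>'(0) = X\<close>.\<close>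

definition lie_exp :: "'g lie_group \<Rightarrow> 'g vec \<Rightarrow> 'g" where
  "lie_exp G X = (THE \<gamma>. smooth_map real_mfd (gmfd G) \<gamma> \<and>
      (\<forall>s t. \<gamma> (s + t) = \<gamma> s \<otimes>\<^bsub>G\<^esub> \<gamma> t) \<and>
      (\<forall>f \<in> Cinf (gmfd G). ((\<lambda>t. f (\<gamma> t)) has_real_derivative X f) (at 0))) (1::real)"

definition Ad :: "'g lie_group \<Rightarrow> 'g \<Rightarrow> 'g vec \<Rightarrow> 'g vec" where
  "Ad G g X = (\<lambda>f. if f \<in> Cinf (gmfd G)
      then X (fcomp (gmfd G) f (\<lambda>h. g \<otimes>\<^bsub>G\<^esub> h \<otimes>\<^bsub>G\<^esub> inv\<^bsub>G\<^esub> g)) else 0)"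

text \<open>The fundamental vector field, \<open>X\<^sub>p = d/dt exp(tX) \<cdot> p\<close> at \<open>t = 0\<close>.\<close>

definition fund_vfield :: "'g lie_group \<Rightarrow> 'm mfd \<Rightarrow> ('g \<Rightarrow> 'm \<Rightarrow> 'm) \<Rightarrow> 'g vec \<Rightarrow> 'm vfield" where
  "fund_vfield G M \<phi> X = (\<lambda>f p. if f \<in> Cinf M \<and> p \<in> pts M
      then deriv (\<lambda>t. f (\<phi> (lie_exp G (\<lambda>h. t * X h)) p)) 0 else 0)"


section \<open>Polynomials on the Lie algebra\<close>

definition dual_space :: "'g lie_group \<Rightarrow> ('g vec \<Rightarrow> real) set" where
  "dual_space G = {l. (\<forall>X. X \<notin> lie_algebra G \<longrightarrow> l X = 0) \<and>
     (\<forall>X\<in>lie_algebra G. \<forall>Y\<in>lie_algebra G. l (X + Y) = l X + l Y) \<and>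
     (\<forall>X\<in>lie_algebra G. \<forall>c. l (\<lambda>f. c * X f) = c * l X)}"

text \<open>\<open>S\<^sup>k(\<gg>\<^sup>*)\<close>: linear combinations of products of \<open>k\<close> linear forms.\<close>

definition sym_pow :: "'g lie_group \<Rightarrow> nat \<Rightarrow> ('g vec \<Rightarrow> real) set" where
  "sym_pow G k = {f. \<exists>(n::nat) a l. (\<forall>j<n. \<forall>i<k. l j i \<in> dual_space G) \<and>
     f = (\<lambda>X. if X \<in> lie_algebra G then \<Sum>j<n. a j * (\<Prod>i<k. l j i X) else 0)}"

text \<open>The homogeneous component of degree \<open>k\<close> of a polynomial.\<close>

definition hom_part :: "'g lie_group \<Rightarrow> ('g vec \<Rightarrow> real) \<Rightarrow> nat \<Rightarrow> ('g vec \<Rightarrow> real)" where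
  "hom_part G f = (THE c. (\<forall>k. c k \<in> sym_pow G k) \<and> finite {k. c k \<noteq> 0} \<and>
     f = (\<Sum>k | c k \<noteq> 0. c k))"

definition polys :: "'g lie_group \<Rightarrow> ('g vec \<Rightarrow> real) set" where
  "polys G = {f. \<exists>c n. (\<forall>k. c k \<in> sym_pow G k) \<and> f = (\<Sum>k\<le>(n::nat). c k)}"

text \<open>The ring \<open>S(\<gg>\<^sup>*)\<^sup>G\<close>.\<close>

definition inv_polys :: "'g lie_group \<Rightarrow> ('g vec \<Rightarrow> real) ring" where
  "inv_polys G =
     \<lparr>carrier = {f \<in> polys G. \<forall>g\<in>carrier G. \<forall>X\<in>lie_algebra G. f (Ad G g X) = f X},
      mult = (*), one = (\<lambda>X. if X \<in> lie_algebra G then 1 else 0), zero = 0, add = (+)\<rparr>"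


section \<open>The Cartan model\<close>

type_synonym ('g, 'm) cochain = "'g vec \<Rightarrow> 'm form"

definition pmult :: "('g vec \<Rightarrow> real) \<Rightarrow> ('g, 'm) cochain \<Rightarrow> ('g, 'm) cochain" where
  "pmult f \<omega> = (\<lambda>X Vs p. f X * \<omega> X Vs p)"

text \<open>\<open>S\<^sup>k(\<gg>\<^sup>*) \<otimes> \<Omega>\<^sup>q(M)\<close> as polynomial maps from \<open>\<gg>\<close> to \<open>\<Omega>\<^sup>q(M)\<close>.\<close>

definition sym_forms :: "'g lie_group \<Rightarrow> 'm mfd \<Rightarrow> nat \<Rightarrow> nat \<Rightarrow> ('g, 'm) cochain set" where
  "sym_forms G M k q = {\<omega>. \<exists>(n::nat) f w. (\<forall>j<n. f j \<in> sym_pow G k \<and> w j \<in> forms M q) \<and>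
     \<omega> = (\<lambda>X Vs p. \<Sum>j<n. f j X * w j Vs p)}"

text \<open>The bigraded pieces \<open>C\<^sup>l\<^sup>,\<^sup>q\<close>; integer indices make all pieces outside the first quadrant
  available (and zero).\<close>

definition Cbi :: "'g lie_group \<Rightarrow> 'm mfd \<Rightarrow> ('g \<Rightarrow> 'm \<Rightarrow> 'm) \<Rightarrow> int \<Rightarrow> int \<Rightarrow> ('g, 'm) cochain set" where
  "Cbi G M \<phi> l q =
     (if 0 \<le> l \<and> even l \<and> 0 \<le> q then
        {\<omega> \<in> sym_forms G M (nat l div 2) (nat q). \<forall>g\<in>carrier G. \<forall>X\<in>lie_algebra G.
           \<omega> (Ad G g X) = pull_form M (\<phi> (inv\<^bsub>G\<^esub> g)) (\<omega> X)}
      else {0})"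

text \<open>The degree \<open>n\<close> part of \<open>F\<^sup>pC\<^sub>G(M)\<close>; the sum is a Minkowski sum of subspaces
  (Set_Algebras), with empty sum \<open>{0}\<close>. The summands with \<open>l > n\<close> vanish. In particular
  \<open>p = 0\<close> gives the whole of \<open>C\<^sup>n\<^sub>G(M)\<close>.\<close>

definition FC :: "'g lie_group \<Rightarrow> 'm mfd \<Rightarrow> ('g \<Rightarrow> 'm \<Rightarrow> 'm) \<Rightarrow> int \<Rightarrow> int \<Rightarrow> ('g, 'm) cochain set" where
  "FC G M \<phi> p n = (\<Sum>l\<in>{p..n}. Cbi G M \<phi> l (n - l))"

abbreviation CG :: "'g lie_group \<Rightarrow> 'm mfd \<Rightarrow> ('g \<Rightarrow> 'm \<Rightarrow> 'm) \<Rightarrow> int \<Rightarrow> ('g, 'm) cochain set" where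
  "CG G M \<phi> n \<equiv> FC G M \<phi> 0 n"

definition dG :: "'g lie_group \<Rightarrow> 'm mfd \<Rightarrow> ('g \<Rightarrow> 'm \<Rightarrow> 'm) \<Rightarrow> ('g, 'm) cochain \<Rightarrow> ('g, 'm) cochain" where
  "dG G M \<phi> \<omega> = (\<lambda>X. ext_deriv M (\<omega> X) - contract (fund_vfield G M \<phi> X) (\<omega> X))"

text \<open>Quotients are sets of cosets \<open>z +o B\<close>; the zero element of such a quotient is \<open>B\<close>, and
  addition is addition of sets. The next three definitions are the boundaries of degree \<open>n\<close>,
  the group \<open>H\<^sup>n\<^sub>G(M)\<close>, and the image of \<open>H\<^sup>n(F\<^sup>pC\<^sub>G(M))\<close> in it.\<close>

definition BG :: "'g lie_group \<Rightarrow> 'm mfd \<Rightarrow> ('g \<Rightarrow> 'm \<Rightarrow> 'm) \<Rightarrow> int \<Rightarrow> ('g, 'm) cochain set" where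
  "BG G M \<phi> n = dG G M \<phi> ` CG G M \<phi> (n - 1)"

definition HG :: "'g lie_group \<Rightarrow> 'm mfd \<Rightarrow> ('g \<Rightarrow> 'm \<Rightarrow> 'm) \<Rightarrow> int \<Rightarrow> ('g, 'm) cochain set set" where
  "HG G M \<phi> n = {z +o BG G M \<phi> n | z. z \<in> CG G M \<phi> n \<and> dG G M \<phi> z = 0}"

definition FH :: "'g lie_group \<Rightarrow> 'm mfd \<Rightarrow> ('g \<Rightarrow> 'm \<Rightarrow> 'm) \<Rightarrow> int \<Rightarrow> int \<Rightarrow> ('g, 'm) cochain set set" where
  "FH G M \<phi> p n = {z +o BG G M \<phi> n | z. z \<in> FC G M \<phi> p n \<and> dG G M \<phi> z = 0}"


section \<open>The spectral sequence\<close>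

text \<open>The spectral sequence of a filtered complex:
  \<open>E\<^sub>r\<^sup>p\<^sup>,\<^sup>q = Z\<^sub>r\<^sup>p\<^sup>,\<^sup>q / (Z\<^sub>r\<^sub>-\<^sub>1\<^sup>p\<^sup>+\<^sup>1\<^sup>,\<^sup>q\<^sup>-\<^sup>1 + d Z\<^sub>r\<^sub>-\<^sub>1\<^sup>p\<^sup>-\<^sup>r\<^sup>+\<^sup>1\<^sup>,\<^sup>q\<^sup>+\<^sup>r\<^sup>-\<^sup>2)\<close> where
  \<open>Z\<^sub>r\<^sup>p\<^sup>,\<^sup>q = {c \<in> F\<^sup>pC\<^sup>p\<^sup>+\<^sup>q. d c \<in> F\<^sup>p\<^sup>+\<^sup>rC\<^sup>p\<^sup>+\<^sup>q\<^sup>+\<^sup>1}\<close>.\<close>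

definition Zss :: "'g lie_group \<Rightarrow> 'm mfd \<Rightarrow> ('g \<Rightarrow> 'm \<Rightarrow> 'm) \<Rightarrow> int \<Rightarrow> int \<Rightarrow> int \<Rightarrow> ('g, 'm) cochain set" where
  "Zss G M \<phi> r p q = {c \<in> FC G M \<phi> p (p + q). dG G M \<phi> c \<in> FC G M \<phi> (p + r) (p + q + 1)}"

definition Bss :: "'g lie_group \<Rightarrow> 'm mfd \<Rightarrow> ('g \<Rightarrow> 'm \<Rightarrow> 'm) \<Rightarrow> int \<Rightarrow> int \<Rightarrow> int \<Rightarrow> ('g, 'm) cochain set" where
  "Bss G M \<phi> r p q =
     Zss G M \<phi> (r - 1) (p + 1) (q - 1) + dG G M \<phi> ` Zss G M \<phi> (r - 1) (p - r + 1) (q + r - 2)"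

definition Ess :: "'g lie_group \<Rightarrow> 'm mfd \<Rightarrow> ('g \<Rightarrow> 'm \<Rightarrow> 'm) \<Rightarrow> int \<Rightarrow> int \<Rightarrow> int \<Rightarrow> ('g, 'm) cochain set set" where
  "Ess G M \<phi> r p q = {z +o Bss G M \<phi> r p q | z. z \<in> Zss G M \<phi> r p q}"

text \<open>As the filtration is bounded in each degree, \<open>E\<^sub>r\<^sup>p\<^sup>,\<^sup>q\<close> is, as a set of cosets, the same for
  all sufficiently large \<open>r\<close>; this is \<open>E\<^sub>\<infinity>\<^sup>p\<^sup>,\<^sup>q\<close>, and its zero element is the eventual value
  of \<open>Bss\<close>.\<close>

definition eventual_value :: "(nat \<Rightarrow> 'a) \<Rightarrow> 'a" where
  "eventual_value S = (THE A. \<forall>\<^sub>F r in sequentially. S r = A)"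

definition Binf :: "'g lie_group \<Rightarrow> 'm mfd \<Rightarrow> ('g \<Rightarrow> 'm \<Rightarrow> 'm) \<Rightarrow> int \<Rightarrow> int \<Rightarrow> ('g, 'm) cochain set" where
  "Binf G M \<phi> p q = eventual_value (\<lambda>r. Bss G M \<phi> (int r) p q)"

definition Einf :: "'g lie_group \<Rightarrow> 'm mfd \<Rightarrow> ('g \<Rightarrow> 'm \<Rightarrow> 'm) \<Rightarrow> int \<Rightarrow> int \<Rightarrow> ('g, 'm) cochain set set" where
  "Einf G M \<phi> p q = eventual_value (\<lambda>r. Ess G M \<phi> (int r) p q)"

text \<open>The isomorphism \<open>E\<^sub>\<infinity>\<^sup>p\<^sup>,\<^sup>q \<cong> F\<^sup>pH\<^sup>p\<^sup>+\<^sup>q / F\<^sup>p\<^sup>+\<^sup>1H\<^sup>p\<^sup>+\<^sup>q\<close> sends the class of a cocycle \<open>z\<close> to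
  \<open>[z] + F\<^sup>p\<^sup>+\<^sup>1H\<^sup>p\<^sup>+\<^sup>q\<close>. As \<open>x \<in> E\<^sub>\<infinity>\<^sup>p\<^sup>,\<^sup>q\<close> is the set of all its representing cocycles, this coset is
  the set of the cohomology classes of all elements of \<open>x\<close>.\<close>

definition Einf_iso :: "'g lie_group \<Rightarrow> 'm mfd \<Rightarrow> ('g \<Rightarrow> 'm \<Rightarrow> 'm) \<Rightarrow> int \<Rightarrow> int \<Rightarrow>
    ('g, 'm) cochain set \<Rightarrow> ('g, 'm) cochain set set" where
  "Einf_iso G M \<phi> p q x = (\<lambda>z. z +o BG G M \<phi> (p + q)) ` x"

definition gr_proj :: "'g lie_group \<Rightarrow> 'm mfd \<Rightarrow> ('g \<Rightarrow> 'm \<Rightarrow> 'm) \<Rightarrow> int \<Rightarrow> int \<Rightarrow>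
    ('g, 'm) cochain set \<Rightarrow> ('g, 'm) cochain set set" where
  "gr_proj G M \<phi> p n y = y +o FH G M \<phi> (p + 1) n"


section \<open>The modules \<open>H\<^sup>*\<^sub>G(M)\<close> and \<open>E\<^sub>\<infinity>\<close>\<close>

text \<open>Given quotients \<open>A i\<close> (sets of cosets of \<open>B i\<close>), \<open>graded_module\<close> is their direct sum: families
  with finitely many entries different from the zero coset. An invariant polynomial
  homogeneous of degree \<open>k\<close> multiplies representatives; it maps the component of index
  \<open>sh k i\<close> to that of index \<open>i\<close>. The ring multiplication fields of the record are irrelevant
  for modules.\<close>

definition graded_module :: "'g lie_group \<Rightarrow> ('i \<Rightarrow> ('g, 'm) cochain set set) \<Rightarrow>
    ('i \<Rightarrow> ('g, 'm) cochain set) \<Rightarrow> (nat \<Rightarrow> 'i \<Rightarrow> 'i) \<Rightarrow>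
    ('g vec \<Rightarrow> real, 'i \<Rightarrow> ('g, 'm) cochain set) module" where
  "graded_module G A B sh =
     \<lparr>carrier = {e. (\<forall>i. e i \<in> A i) \<and> finite {i. e i \<noteq> B i}},
      mult = undefined, one = undefined, zero = B, add = (\<lambda>e e' i. e i + e' i),
      smult = (\<lambda>f e i. (\<Sum>k | hom_part G f k \<noteq> 0. pmult (hom_part G f k) ` e (sh k i)) + B i)\<rparr>"

definition HG_module :: "'g lie_group \<Rightarrow> 'm mfd \<Rightarrow> ('g \<Rightarrow> 'm \<Rightarrow> 'm) \<Rightarrow>
    ('g vec \<Rightarrow> real, int \<Rightarrow> ('g, 'm) cochain set) module" where
  "HG_module G M \<phi> = graded_module G (HG G M \<phi>) (BG G M \<phi>) (\<lambda>k n. n - 2 * int k)"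

definition Einf_module :: "'g lie_group \<Rightarrow> 'm mfd \<Rightarrow> ('g \<Rightarrow> 'm \<Rightarrow> 'm) \<Rightarrow>
    ('g vec \<Rightarrow> real, int \<times> int \<Rightarrow> ('g, 'm) cochain set) module" where
  "Einf_module G M \<phi> = graded_module G (\<lambda>(p, q). Einf G M \<phi> p q) (\<lambda>(p, q). Binf G M \<phi> p q)
     (\<lambda>k (p, q). (p - 2 * int k, q))"

text \<open>The homogeneous element of a direct sum (with zero family \<open>\<zero>\<^bsub>N\<^esub>\<close>) with entry \<open>x\<close> at \<open>i\<close>.\<close>

definition homog :: "('r, 'i \<Rightarrow> 'b) module \<Rightarrow> 'i \<Rightarrow> 'b \<Rightarrow> 'i \<Rightarrow> 'b" where
  "homog N i x = \<zero>\<^bsub>N\<^esub>(i := x)"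

definition generates :: "'r ring \<Rightarrow> ('r, 'b) module \<Rightarrow> nat \<Rightarrow> (nat \<Rightarrow> 'b) \<Rightarrow> bool" where
  "generates R N k x \<longleftrightarrow> (\<forall>i<k. x i \<in> carrier N) \<and>
     (\<forall>e\<in>carrier N. \<exists>a\<in>{..<k} \<rightarrow> carrier R. e = (\<Oplus>\<^bsub>N\<^esub>i\<in>{..<k}. a i \<odot>\<^bsub>N\<^esub> x i))"

end

theory Submission
  imports Defs
begin

text \<open>
  The filtration of \<open>H\<^sup>n\<^sub>G(M)\<close> is finite: \<open>F\<^sup>0\<close> is everything and \<open>F\<^sup>p\<close> is zero for \<open>p > n\<close>. A set
  that generates the associated graded module therefore lifts to generators. Given a class \<open>[c]\<close>
  in \<open>F\<^sup>pH\<^sup>n\<close>, its image in \<open>E\<^sub>\<infinity>\<^sup>p\<^sup>,\<^sup>n\<^sup>-\<^sup>p\<close> is \<open>\<Sum>\<^sub>i f\<^sub>i x\<^sub>i\<close>, where the \<open>f\<^sub>i\<close> can be taken homogeneous of the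
  degree that leads from the bidegree of \<open>x\<^sub>i\<close> to \<open>(p, n - p)\<close>. Then \<open>[c] - \<Sum>\<^sub>i f\<^sub>i y\<^sub>i\<close> lies in
  \<open>F\<^sup>p\<^sup>+\<^sup>1H\<^sup>n\<close>, and the argument is repeated with \<open>p + 1\<close>. This induction is
  \<open>cocycle_combination_by_filtration\<close>.

  The induction is carried out on cochains, and three facts connect it with the modules.
  First, for large \<open>r\<close> one has \<open>E\<^sub>r\<^sup>p\<^sup>,\<^sup>q = Z / (Z' + (B \<inter> F\<^sup>p))\<close> with the cocycles \<open>Z\<close> in \<open>F\<^sup>p\<close>, the
  cocycles \<open>Z'\<close> in \<open>F\<^sup>p\<^sup>+\<^sup>1\<close> and the coboundaries \<open>B\<close> (\<open>Binf_eq\<close>, \<open>Einf_eq\<close>); consequently \<open>x\<^sub>i\<close> and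
  \<open>y\<^sub>i\<close> are classes of one and the same cocycle (\<open>common_representative\<close>).
  Second, generation of a direct sum of quotients by homogeneous elements is equivalent to a
  statement about representatives and homogeneous coefficients (\<open>generates_quot_iff\<close>). This rests
  on the uniqueness and the invariance of the homogeneous components of an invariant polynomial
  (\<open>hom_part_eqI\<close>, \<open>inv_polys_hom_part\<close>), which follow by scaling the argument.
  Third, multiplication by an invariant polynomial of degree \<open>k\<close> commutes with \<open>d\<^sub>G\<close> and raises
  the filtration and the total degree by \<open>2k\<close> (\<open>dG_pmult\<close>, \<open>pmult_FC\<close>), so that it preserves
  cocycles and coboundaries.
\<close>

section \<open>Linear combinations of smooth functions\<close>

lemma continuous_map_fun_upd:
  assumes "x \<in> topspace (Euclidean_space n)" and "i < n"
  shows "continuous_map euclideanreal (Euclidean_space n) (\<lambda>t. x(i := t))"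
  using assms
  by (auto simp: Euclidean_space_def continuous_map_in_subtopology continuous_map_componentwise_UNIV)

lemma eventually_fun_upd_in_open:
  assumes "openin (Euclidean_space n) U" and "x \<in> U" and "i < n"
  shows "\<forall>\<^sub>F t in nhds (x i). x(i := t) \<in> U"
proof -
  have "x \<in> topspace (Euclidean_space n)"
    using assms openin_subset by blast
  then have "openin euclideanreal {t \<in> topspace euclideanreal. x(i := t) \<in> U}"
    using continuous_map_fun_upd assms(1,3) openin_continuous_map_preimage by blast
  then show ?thesis
    using assms(2) by (auto simp: eventually_nhds intro!: exI[of _ "{t. x(i := t) \<in> U}"])
qed

text \<open>The values of a function at points near \<open>x\<close> enter into its partial derivatives at \<open>x\<close>, so
  being \<open>C^k\<close> on \<open>U\<close> depends only on the values on \<open>U\<close> as soon as \<open>U\<close> is open. This is what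
  allows the derivative of a linear combination, which is known on \<open>U\<close> only, to be replaced by
  the linear combination of the derivatives.\<close>

lemma Ck_on_cong:
  assumes "openin (Euclidean_space n) U" and "\<And>x. x \<in> U \<Longrightarrow> f x = g x" and "Ck_on n k U f"
  shows "Ck_on n k U g"
  using assms(2,3)
proof (induction k arbitrary: f g)
  case 0
  then show ?case
    by (auto intro: continuous_map_eq)
next
  case (Suc k)
  have ev: "\<forall>\<^sub>F t in nhds (x i). f (x(i := t)) = g (x(i := t))" if "x \<in> U" "i < n" for x i
    using eventually_fun_upd_in_open[OF assms(1) that] by eventually_elim (rule Suc.prems(1))
  have "(\<lambda>t. g (x(i := t))) differentiable at (x i)" if "x \<in> U" "i < n" for x i
  proof -
    have "(\<lambda>t. f (x(i := t))) differentiable at (x i)"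
      using Suc.prems(2) that by simp
    then obtain D where "((\<lambda>t. f (x(i := t))) has_real_derivative D) (at (x i))"
      using real_differentiable_def by blast
    then have "((\<lambda>t. g (x(i := t))) has_real_derivative D) (at (x i))"
      using DERIV_cong_ev[OF refl ev[OF that] refl] by simp
    then show ?thesis
      using real_differentiable_def by blast
  qed
  moreover have "Ck_on n k U (\<lambda>x. deriv (\<lambda>t. g (x(i := t))) (x i))" if "i < n" for i
    by (rule Suc.IH[of "\<lambda>x. deriv (\<lambda>t. f (x(i := t))) (x i)"])
      (use that Suc.prems(2) in \<open>simp_all add: deriv_cong_ev[OF ev refl] del: fun_upd_apply\<close>)
  moreover have "continuous_map (subtopology (Euclidean_space n) U) euclideanreal g"
    using Suc.prems by (auto intro: continuous_map_eq)
  ultimately show ?case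
    by simp
qed

lemma Ck_on_linear_combination:
  assumes "openin (Euclidean_space n) U" and "Ck_on n k U f" and "Ck_on n k U g"
  shows "Ck_on n k U (\<lambda>x. a * f x + g x)"
  using assms(2,3)
proof (induction k arbitrary: f g)
  case 0
  then show ?case
    by (auto intro!: continuous_map_add continuous_map_real_mult_left)
next
  case (Suc k)
  have "(\<lambda>t. a * f (x(i := t)) + g (x(i := t))) differentiable at (x i)" if "x \<in> U" "i < n" for x i
    using Suc.prems that by (auto intro!: derivative_intros)
  moreover have "Ck_on n k U (\<lambda>x. deriv (\<lambda>t. a * f (x(i := t)) + g (x(i := t))) (x i))"
    if "i < n" for i
  proof (rule Ck_on_cong[OF assms(1)])
    show "Ck_on n k U (\<lambda>x. a * deriv (\<lambda>t. f (x(i := t))) (x i) + deriv (\<lambda>t. g (x(i := t))) (x i))"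
      using Suc that by simp
    fix x assume "x \<in> U"
    then have "((\<lambda>t. f (x(i := t))) has_real_derivative deriv (\<lambda>t. f (x(i := t))) (x i)) (at (x i))"
        "((\<lambda>t. g (x(i := t))) has_real_derivative deriv (\<lambda>t. g (x(i := t))) (x i)) (at (x i))"
      using Suc.prems that by (auto simp: DERIV_deriv_iff_real_differentiable)
    then show "a * deriv (\<lambda>t. f (x(i := t))) (x i) + deriv (\<lambda>t. g (x(i := t))) (x i) =
        deriv (\<lambda>t. a * f (x(i := t)) + g (x(i := t))) (x i)"
      by (intro DERIV_imp_deriv[symmetric] DERIV_add DERIV_cmult)
  qed
  ultimately show ?case
    using Suc.prems by (auto intro!: continuous_map_add continuous_map_real_mult_left)
qed

lemma Ck_on_zero: "Ck_on n k U (\<lambda>x. 0)"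
  by (induction k) auto

lemma openin_chart_image:
  assumes "smooth_manifold M" and "(U, \<phi>) \<in> atlas M"
  shows "openin (Euclidean_space (mdim M)) (\<phi> ` U)"
proof -
  obtain V where U: "openin (mtop M) U" and V: "openin (Euclidean_space (mdim M)) V"
      "homeomorphic_map (subtopology (mtop M) U) (subtopology (Euclidean_space (mdim M)) V) \<phi>"
    using assms unfolding smooth_manifold_def by blast
  then have "\<phi> ` U = V"
    using homeomorphic_imp_surjective_map[OF V(2)] openin_subset
    by (metis topspace_subtopology_subset)
  then show ?thesis
    using V by simp
qed

lemma Cinf_zero: "0 \<in> Cinf M"
  by (auto simp: Cinf_def smooth_on_def Ck_on_zero)

lemma Cinf_linear_combination:
  assumes "smooth_manifold M" and "f \<in> Cinf M" and "g \<in> Cinf M"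
  shows "(\<lambda>_. a) * f + g \<in> Cinf M"
  using assms openin_chart_image[OF assms(1)]
  by (fastforce simp: Cinf_def smooth_on_def intro!: Ck_on_linear_combination)

lemma Cinf_sum:
  assumes "smooth_manifold M" and "\<And>i. i \<in> I \<Longrightarrow> f i \<in> Cinf M"
  shows "(\<Sum>i\<in>I. (\<lambda>_. a i) * f i) \<in> Cinf M"
  using assms(2)
  by (induction I rule: infinite_finite_induct)
    (auto intro: Cinf_zero Cinf_linear_combination assms(1))


section \<open>Linearity of the equivariant differential\<close>

text \<open>Vector fields are additive on \<open>C^\<infinity>(M)\<close> and set to zero off it, so the differential is
  linear only on cochains all of whose values are smooth functions. Unlike the space of
  cochains of one bidegree, this set also contains the inhomogeneous cochains that occur in the
  filtration.\<close>

definition smooth_valued :: "'m mfd \<Rightarrow> ('g, 'm) cochain set" where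
  "smooth_valued M = {\<omega>. \<forall>X Vs. \<omega> X Vs \<in> Cinf M}"

lemma vfield_linear_combination:
  assumes "smooth_manifold M" and "V \<in> vfields M" and "f \<in> Cinf M" and "g \<in> Cinf M"
  shows "V ((\<lambda>_. a) * f + g) = (\<lambda>_. a) * V f + V g"
proof -
  have "(\<lambda>_. a) * f \<in> Cinf M"
    using Cinf_linear_combination[OF assms(1,3) Cinf_zero, of a] by simp
  then have "V ((\<lambda>_. a) * f + g) = V ((\<lambda>_. a) * f) + V g"
    using assms by (simp add: vfields_def)
  also have "V ((\<lambda>_. a) * f) = (\<lambda>_. a) * V f"
    using assms by (simp add: vfields_def times_fun_def)
  finally show ?thesis .
qed

lemma ext_deriv_linear_combination:
  assumes "smooth_manifold M" and "\<And>Vs. \<omega> Vs \<in> Cinf M" and "\<And>Vs. \<eta> Vs \<in> Cinf M"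
  shows "ext_deriv M (\<lambda>Vs. (\<lambda>_. a) * \<omega> Vs + \<eta> Vs) Vs =
    (\<lambda>_. a) * ext_deriv M \<omega> Vs + ext_deriv M \<eta> Vs"
proof (cases "Vs \<noteq> [] \<and> set Vs \<subseteq> vfields M")
  case True
  have "(Vs ! i) ((\<lambda>_. a) * \<omega> Ws + \<eta> Ws) = (\<lambda>_. a) * (Vs ! i) (\<omega> Ws) + (Vs ! i) (\<eta> Ws)"
    if "i < length Vs" for i Ws
    using True that assms by (intro vfield_linear_combination) auto
  then show ?thesis
    using True by (simp add: ext_deriv_def sum.distrib sum_distrib_left algebra_simps)
next
  case False
  then show ?thesis
    by (auto simp: ext_deriv_def)
qed

text \<open>The coefficient \<open>f\<close> is a function of \<open>X \<in> \<gg>\<close>, and \<open>dG\<close> is computed separately for each \<open>X\<close>,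
  where \<open>f X\<close> is a constant. Hence \<open>dG\<close> is linear over polynomials without any derivative of
  \<open>f\<close>.\<close>

lemma dG_linear_combination:
  assumes "smooth_manifold M" and "\<omega> \<in> smooth_valued M" and "\<eta> \<in> smooth_valued M"
  shows "dG G M \<phi> (pmult f \<omega> + \<eta>) = pmult f (dG G M \<phi> \<omega>) + dG G M \<phi> \<eta>"
proof (intro ext)
  fix X Vs p
  have "(pmult f \<omega> + \<eta>) X = (\<lambda>Vs. (\<lambda>_. f X) * \<omega> X Vs + \<eta> X Vs)"
    by (simp add: pmult_def fun_eq_iff)
  moreover have "ext_deriv M \<dots> Vs = (\<lambda>_. f X) * ext_deriv M (\<omega> X) Vs + ext_deriv M (\<eta> X) Vs"
    using assms by (intro ext_deriv_linear_combination) (auto simp: smooth_valued_def)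
  ultimately show "dG G M \<phi> (pmult f \<omega> + \<eta>) X Vs p = (pmult f (dG G M \<phi> \<omega>) + dG G M \<phi> \<eta>) X Vs p"
    by (simp add: dG_def contract_def pmult_def algebra_simps)
qed

lemma pmult_simps [simp]:
  "pmult f 0 = 0" "pmult 0 \<omega> = 0" "pmult (\<lambda>_. 1) \<omega> = \<omega>" "pmult (\<lambda>_. - 1) \<omega> = - \<omega>"
  by (auto simp: pmult_def fun_eq_iff)

lemma pmult_add_right: "pmult f (\<omega> + \<eta>) = pmult f \<omega> + pmult f \<eta>"
  and pmult_add_left: "pmult (f + g) \<omega> = pmult f \<omega> + pmult g \<omega>"
  and pmult_minus_right: "pmult f (\<omega> - \<eta>) = pmult f \<omega> - pmult f \<eta>"
  by (auto simp: pmult_def fun_eq_iff algebra_simps)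

lemma pmult_sum_right: "pmult f (\<Sum>i\<in>I. \<omega> i) = (\<Sum>i\<in>I. pmult f (\<omega> i))"
  by (induction I rule: infinite_finite_induct) (simp_all only: sum.infinite sum.empty sum.insert pmult_simps pmult_add_right not_False_eq_True)

lemma zero_smooth_valued: "0 \<in> smooth_valued M"
  using Cinf_zero by (auto simp: smooth_valued_def zero_fun_def)

lemma smooth_valued_linear_combination:
  assumes "smooth_manifold M" and "\<omega> \<in> smooth_valued M" and "\<eta> \<in> smooth_valued M"
  shows "pmult f \<omega> + \<eta> \<in> smooth_valued M"
proof -
  have "(pmult f \<omega> + \<eta>) X Vs = (\<lambda>_. f X) * \<omega> X Vs + \<eta> X Vs" for X Vs
    by (auto simp: pmult_def)
  then show ?thesis
    using assms Cinf_linear_combination[OF assms(1)] by (simp add: smooth_valued_def)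
qed

lemma smooth_valued_add:
  assumes "smooth_manifold M" and "\<omega> \<in> smooth_valued M" and "\<eta> \<in> smooth_valued M"
  shows "\<omega> + \<eta> \<in> smooth_valued M"
  using smooth_valued_linear_combination[OF assms, of "\<lambda>_. 1"] by simp

lemma smooth_valued_sum:
  assumes "smooth_manifold M" and "\<And>i. i \<in> I \<Longrightarrow> \<omega> i \<in> smooth_valued M"
  shows "(\<Sum>i\<in>I. \<omega> i) \<in> smooth_valued M"
  using assms(2)
  by (induction I rule: infinite_finite_induct)
    (auto intro: zero_smooth_valued smooth_valued_add assms(1))

lemma dG_zero [simp]: "smooth_manifold M \<Longrightarrow> dG G M \<phi> 0 = 0"
  using dG_linear_combination[OF _ zero_smooth_valued zero_smooth_valued, of M G \<phi> "\<lambda>_. 1"] by simp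

lemma dG_pmult:
  assumes "smooth_manifold M" and "\<omega> \<in> smooth_valued M"
  shows "dG G M \<phi> (pmult f \<omega>) = pmult f (dG G M \<phi> \<omega>)"
  using dG_linear_combination[OF assms zero_smooth_valued, of G \<phi> f] assms(1) by simp

lemma dG_diff:
  assumes "smooth_manifold M" and "\<omega> \<in> smooth_valued M" and "\<eta> \<in> smooth_valued M"
  shows "dG G M \<phi> (\<omega> - \<eta>) = dG G M \<phi> \<omega> - dG G M \<phi> \<eta>"
  using dG_linear_combination[OF assms(1,3,2), of G \<phi> "\<lambda>_. - 1"] by simp


section \<open>Additive subgroups and finite sums\<close>

definition add_subgroup :: "'a::ab_group_add set \<Rightarrow> bool" where
  "add_subgroup S \<longleftrightarrow> 0 \<in> S \<and> (\<forall>a\<in>S. \<forall>b\<in>S. a - b \<in> S)"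

lemma add_subgroup_zero: "add_subgroup S \<Longrightarrow> 0 \<in> S"
  and add_subgroup_diff: "add_subgroup S \<Longrightarrow> a \<in> S \<Longrightarrow> b \<in> S \<Longrightarrow> a - b \<in> S"
  by (auto simp: add_subgroup_def)

lemma add_subgroup_add:
  assumes "add_subgroup S" and "a \<in> S" and "b \<in> S"
  shows "a + b \<in> S"
proof -
  have "a - (0 - b) \<in> S"
    using assms by (intro add_subgroup_diff) (auto dest: add_subgroup_zero)
  then show ?thesis
    by simp
qed

lemma add_subgroup_sum:
  assumes "add_subgroup S" and "\<And>i. i \<in> I \<Longrightarrow> f i \<in> S"
  shows "(\<Sum>i\<in>I. f i) \<in> S"
  using assms(2)
proof (induction I rule: infinite_finite_induct)
  case (insert i I)
  then show ?case
    by (simp only: sum.insert not_False_eq_True) (simp add: add_subgroup_add[OF assms(1)])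
qed (simp_all only: sum.infinite sum.empty add_subgroup_zero[OF assms(1)] not_False_eq_True)

lemma add_subgroup_set_sum:
  assumes "finite I" and "\<And>i. i \<in> I \<Longrightarrow> add_subgroup (S i)"
  shows "add_subgroup (\<Sum>i\<in>I. S i)"
  unfolding add_subgroup_def set_sum_alt[OF assms(1)]
proof (intro conjI ballI)
  show "0 \<in> {sum s I |s. \<forall>i\<in>I. s i \<in> S i}"
    using assms(2) by (auto intro!: exI[of _ "\<lambda>_. 0"] simp: add_subgroup_zero)
  fix a b assume "a \<in> {sum s I |s. \<forall>i\<in>I. s i \<in> S i}" "b \<in> {sum s I |s. \<forall>i\<in>I. s i \<in> S i}"
  then obtain s t where "a = sum s I" "\<forall>i\<in>I. s i \<in> S i" "b = sum t I" "\<forall>i\<in>I. t i \<in> S i"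
    by blast
  then have "a - b = sum (\<lambda>i. s i - t i) I" "\<forall>i\<in>I. s i - t i \<in> S i"
    using assms(2) by (auto simp: sum_subtractf add_subgroup_diff)
  then show "a - b \<in> {sum s I |s. \<forall>i\<in>I. s i \<in> S i}"
    by (intro CollectI exI[of _ "\<lambda>i. s i - t i"] conjI)
qed

lemma sum_fun_apply: "(\<Sum>i\<in>I. f i) x = (\<Sum>i\<in>I. f i x)"
  by (induction I rule: infinite_finite_induct) simp_all

lemma sum_lessThan_append:
  fixes f g :: "nat \<Rightarrow> 'b::comm_monoid_add"
  shows "(\<Sum>j<n + m. if j < n then f j else g (j - n)) = (\<Sum>j<n. f j) + (\<Sum>j<m. g j)"
  by (induction m) (simp_all add: add.assoc)

lemma prod_lessThan_append:
  fixes f g :: "nat \<Rightarrow> 'b::comm_monoid_mult"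
  shows "(\<Prod>j<n + m. if j < n then f j else g (j - n)) = (\<Prod>j<n. f j) * (\<Prod>j<m. g j)"
  by (induction m) (simp_all add: mult.assoc)


section \<open>Invariant polynomials and their homogeneous components\<close>

lemma sym_powI:
  fixes n :: nat
  assumes "\<And>j i. j < n \<Longrightarrow> i < k \<Longrightarrow> l j i \<in> dual_space G"
    and "\<And>X. X \<in> lie_algebra G \<Longrightarrow> f X = (\<Sum>j<n. a j * (\<Prod>i<k. l j i X))"
    and "\<And>X. X \<notin> lie_algebra G \<Longrightarrow> f X = 0"
  shows "f \<in> sym_pow G k"
proof -
  have "f = (\<lambda>X. if X \<in> lie_algebra G then \<Sum>j<(n::nat). a j * (\<Prod>i<k. l j i X) else 0)"
    using assms by (auto simp: fun_eq_iff)
  then show ?thesis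
    using assms(1) unfolding sym_pow_def by blast
qed

lemma sym_powD:
  assumes "f \<in> sym_pow G k"
  shows "\<exists>(n::nat) a l. (\<forall>j<n. \<forall>i<k. l j i \<in> dual_space G) \<and>
    (\<forall>X\<in>lie_algebra G. f X = (\<Sum>j<n. a j * (\<Prod>i<k. l j i X))) \<and>
    (\<forall>X. X \<notin> lie_algebra G \<longrightarrow> f X = 0)"
proof -
  obtain n :: nat and a l where "\<forall>j<n. \<forall>i<k. l j i \<in> dual_space G"
      and "f = (\<lambda>X. if X \<in> lie_algebra G then \<Sum>j<n. a j * (\<Prod>i<k. l j i X) else 0)"
    using assms unfolding sym_pow_def by blast
  then show ?thesis
    by (intro exI[of _ n] exI[of _ a] exI[of _ l]) simp
qed

lemma sym_pow_zero: "0 \<in> sym_pow G k"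
  by (rule sym_powI[of 0]) auto

lemma sym_pow_add:
  assumes "f \<in> sym_pow G k" and "g \<in> sym_pow G k"
  shows "f + g \<in> sym_pow G k"
proof -
  obtain n :: nat and a l where f: "\<forall>j<n. \<forall>i<k. l j i \<in> dual_space G"
      "\<forall>X\<in>lie_algebra G. f X = (\<Sum>j<n. a j * (\<Prod>i<k. l j i X))"
      "\<forall>X. X \<notin> lie_algebra G \<longrightarrow> f X = 0"
    using sym_powD[OF assms(1)] by blast
  obtain m :: nat and b u where g: "\<forall>j<m. \<forall>i<k. u j i \<in> dual_space G"
      "\<forall>X\<in>lie_algebra G. g X = (\<Sum>j<m. b j * (\<Prod>i<k. u j i X))"
      "\<forall>X. X \<notin> lie_algebra G \<longrightarrow> g X = 0"
    using sym_powD[OF assms(2)] by blast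
  show ?thesis
  proof (rule sym_powI[of "n + m" k "\<lambda>j. if j < n then l j else u (j - n)" _ _
        "\<lambda>j. if j < n then a j else b (j - n)"])
    fix X assume X: "X \<in> lie_algebra G"
    have "(f + g) X = (\<Sum>j<n + m. if j < n then a j * (\<Prod>i<k. l j i X)
        else b (j - n) * (\<Prod>i<k. u (j - n) i X))"
      using f g X sum_lessThan_append[where n = n and m = m and f = "\<lambda>j. a j * (\<Prod>i<k. l j i X)"
          and g = "\<lambda>j. b j * (\<Prod>i<k. u j i X)"] by simp
    also have "\<dots> = (\<Sum>j<n + m. (if j < n then a j else b (j - n)) *
        (\<Prod>i<k. (if j < n then l j else u (j - n)) i X))"
      by (intro sum.cong) auto
    finally show "(f + g) X = \<dots>" .
  qed (use f g in auto)
qed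

lemma sym_pow_cmult:
  assumes "f \<in> sym_pow G k"
  shows "(\<lambda>_. c) * f \<in> sym_pow G k"
proof -
  obtain n :: nat and a l where f: "\<forall>j<n. \<forall>i<k. l j i \<in> dual_space G"
      "\<forall>X\<in>lie_algebra G. f X = (\<Sum>j<n. a j * (\<Prod>i<k. l j i X))"
      "\<forall>X. X \<notin> lie_algebra G \<longrightarrow> f X = 0"
    using sym_powD[OF assms] by blast
  show ?thesis
    by (rule sym_powI[of n k l _ _ "\<lambda>j. c * a j"])
      (use f in \<open>auto simp: sum_distrib_left mult.assoc\<close>)
qed

lemma add_subgroup_sym_pow: "add_subgroup (sym_pow G k)"
  unfolding add_subgroup_def
proof (intro conjI ballI)
  fix f g assume fg: "f \<in> sym_pow G k" "g \<in> sym_pow G k"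
  have "f - g = f + (\<lambda>_. - 1) * g"
    by (simp add: fun_eq_iff)
  then show "f - g \<in> sym_pow G k"
    using fg by (simp only: sym_pow_add sym_pow_cmult)
qed (rule sym_pow_zero)

lemma sym_pow_mult:
  assumes "f \<in> sym_pow G k" and "g \<in> sym_pow G m"
  shows "f * g \<in> sym_pow G (k + m)"
proof -
  obtain n :: nat and a l where f: "\<forall>j<n. \<forall>i<k. l j i \<in> dual_space G"
      "\<forall>X\<in>lie_algebra G. f X = (\<Sum>j<n. a j * (\<Prod>i<k. l j i X))"
      "\<forall>X. X \<notin> lie_algebra G \<longrightarrow> f X = 0"
    using sym_powD[OF assms(1)] by blast
  obtain N :: nat and b u where g: "\<forall>j<N. \<forall>i<m. u j i \<in> dual_space G"
      "\<forall>X\<in>lie_algebra G. g X = (\<Sum>j<N. b j * (\<Prod>i<m. u j i X))"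
      "\<forall>X. X \<notin> lie_algebra G \<longrightarrow> g X = 0"
    using sym_powD[OF assms(2)] by blast
  define summand where "summand j X = (if X \<in> lie_algebra G then a j * (\<Prod>i<k. l j i X) * g X else 0)"
    for j X
  have "summand j \<in> sym_pow G (k + m)" if "j < n" for j
  proof (rule sym_powI[of N "k + m" "\<lambda>j' i. if i < k then l j i else u j' (i - k)" _ _
        "\<lambda>j'. a j * b j'"])
    fix X assume X: "X \<in> lie_algebra G"
    have "(\<Prod>i<k + m. (if i < k then l j i else u j' (i - k)) X) =
        (\<Prod>i<k. l j i X) * (\<Prod>i<m. u j' i X)" for j'
      by (subst prod_lessThan_append[symmetric]) (auto intro: prod.cong)
    then show "summand j X = (\<Sum>j'<N. a j * b j' *
        (\<Prod>i<k + m. (if i < k then l j i else u j' (i - k)) X))"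
      using X by (simp add: summand_def g sum_distrib_left algebra_simps)
  qed (use f g that in \<open>auto simp: summand_def\<close>)
  then have "(\<Sum>j<n. summand j) \<in> sym_pow G (k + m)"
    by (intro add_subgroup_sum[OF add_subgroup_sym_pow]) auto
  moreover have "(f * g) X = (\<Sum>j<n. summand j) X" for X
    using f by (cases "X \<in> lie_algebra G") (simp_all add: sum_fun_apply summand_def sum_distrib_right)
  ultimately show ?thesis
    by (metis ext)
qed

lemma lie_algebra_scale:
  assumes "X \<in> lie_algebra G"
  shows "(\<lambda>h. t * X h) \<in> lie_algebra G"
  using assms by (auto simp: lie_algebra_def tangent_def algebra_simps)

lemma lie_algebra_scale_iff:
  assumes "t \<noteq> 0"
  shows "(\<lambda>h. t * X h) \<in> lie_algebra G \<longleftrightarrow> X \<in> lie_algebra G"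
proof
  assume "(\<lambda>h. t * X h) \<in> lie_algebra G"
  from lie_algebra_scale[OF this, of "inverse t"] show "X \<in> lie_algebra G"
    using assms by (simp add: field_simps)
qed (rule lie_algebra_scale)

text \<open>Homogeneity. It is available for all \<open>X\<close>, also outside the Lie algebra, because scaling by
  \<open>t \<noteq> 0\<close> preserves the complement of the Lie algebra, where polynomials vanish.\<close>

lemma sym_pow_scale:
  assumes "f \<in> sym_pow G k" and "t \<noteq> 0"
  shows "f (\<lambda>h. t * X h) = t ^ k * f X"
proof -
  obtain n :: nat and a l where f: "\<forall>j<n. \<forall>i<k. l j i \<in> dual_space G"
      "\<forall>X\<in>lie_algebra G. f X = (\<Sum>j<n. a j * (\<Prod>i<k. l j i X))"
      "\<forall>X. X \<notin> lie_algebra G \<longrightarrow> f X = 0"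
    using sym_powD[OF assms(1)] by blast
  show ?thesis
  proof (cases "X \<in> lie_algebra G")
    case True
    have "(\<Prod>i<k. l j i (\<lambda>h. t * X h)) = t ^ k * (\<Prod>i<k. l j i X)" if "j < n" for j
    proof -
      have "l j i (\<lambda>h. t * X h) = t * l j i X" if "i < k" for i
        using f(1) \<open>j < n\<close> that True by (simp add: dual_space_def)
      then show ?thesis
        by (simp add: prod.distrib)
    qed
    then show ?thesis
      using True by (simp add: f lie_algebra_scale sum_distrib_left algebra_simps)
  next
    case False
    then show ?thesis
      using assms(2) by (simp add: f lie_algebra_scale_iff)
  qed
qed

lemma poly_coeffs_eq_of_nonzero:
  fixes a b :: "nat \<Rightarrow> real"
  assumes "\<And>t. t \<noteq> 0 \<Longrightarrow> (\<Sum>k\<le>N. t ^ k * a k) = (\<Sum>k\<le>N. t ^ k * b k)" and "k \<le> N"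
  shows "a k = b k"
proof -
  have "(\<Sum>k\<le>N. (a k - b k) * t ^ k) = (\<Sum>k\<le>N. t ^ k * a k) - (\<Sum>k\<le>N. t ^ k * b k)" for t
    by (simp add: sum_subtractf[symmetric] algebra_simps)
  then have "- {0::real} \<subseteq> {t. (\<Sum>k\<le>N. (a k - b k) * t ^ k) = 0}"
    using assms(1) by auto
  moreover have "infinite (- {0::real})"
    using infinite_UNIV_char_0[where 'a = real] by (simp add: Compl_eq_Diff_UNIV)
  ultimately have "infinite {t. (\<Sum>k\<le>N. (a k - b k) * t ^ k) = 0}"
    using finite_subset by blast
  then show ?thesis
    using polyfun_finite_roots[of "\<lambda>k. a k - b k" N] assms(2) by auto
qed

lemma sum_sym_pow_scale:
  assumes "\<And>k. c k \<in> sym_pow G k" and "t \<noteq> 0"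
  shows "(\<Sum>k\<le>N. c k) (\<lambda>h. t * X h) = (\<Sum>k\<le>N. t ^ k * c k X)"
  unfolding sum_fun_apply by (intro sum.cong refl sym_pow_scale[OF assms])

lemma sum_nonzero_eq_sum_atMost:
  fixes c :: "nat \<Rightarrow> 'b::comm_monoid_add"
  assumes "{k. c k \<noteq> 0} \<subseteq> {..N}"
  shows "(\<Sum>k | c k \<noteq> 0. c k) = (\<Sum>k\<le>N. c k)"
  using assms by (intro sum.mono_neutral_left) auto

text \<open>The homogeneous components are determined by the polynomial: evaluating it at \<open>t X\<close> for
  \<open>t \<noteq> 0\<close> gives a real polynomial in \<open>t\<close> whose coefficients are the values of the components
  at \<open>X\<close>.\<close>

lemma hom_part_eqI:
  assumes c: "\<And>k. c k \<in> sym_pow G k" and fin: "finite {k. c k \<noteq> 0}"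
    and f: "f = (\<Sum>k | c k \<noteq> 0. c k)"
  shows "hom_part G f = c"
  unfolding hom_part_def
proof (rule the_equality)
  fix c' assume c': "(\<forall>k. c' k \<in> sym_pow G k) \<and> finite {k. c' k \<noteq> 0} \<and>
    f = (\<Sum>k | c' k \<noteq> 0. c' k)"
  then have "finite ({k. c k \<noteq> 0} \<union> {k. c' k \<noteq> 0})"
    using fin by blast
  then obtain N where N: "{k. c k \<noteq> 0} \<union> {k. c' k \<noteq> 0} \<subseteq> {..N}"
    using finite_nat_iff_bounded_le by meson
  have sums: "(\<Sum>k\<le>N. c' k) = (\<Sum>k\<le>N. c k)"
    using f c' N sum_nonzero_eq_sum_atMost[of c N] sum_nonzero_eq_sum_atMost[of c' N]
    by (metis Un_subset_iff)
  show "c' = c"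
  proof (intro ext)
    fix k X
    show "c' k X = c k X"
    proof (cases "k \<le> N")
      case True
      have "(\<Sum>k\<le>N. t ^ k * c' k X) = (\<Sum>k\<le>N. t ^ k * c k X)" if "t \<noteq> 0" for t
        using sum_sym_pow_scale[of c' G t N X] sum_sym_pow_scale[of c G t N X] c c' that sums by simp
      from poly_coeffs_eq_of_nonzero[OF this True] show ?thesis .
    next
      case False
      then have "c k = 0" "c' k = 0"
        using N by auto
      then show ?thesis
        by simp
    qed
  qed
qed (use assms in auto)

lemma polys_hom_part:
  assumes "f \<in> polys G"
  shows "hom_part G f k \<in> sym_pow G k"
    and "finite {k. hom_part G f k \<noteq> 0}"
    and "f = (\<Sum>k | hom_part G f k \<noteq> 0. hom_part G f k)"
proof -
  obtain c and n :: nat where c: "\<And>k. c k \<in> sym_pow G k" and f: "f = (\<Sum>k\<le>n. c k)"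
    using assms unfolding polys_def by blast
  define c' where "c' k = (if k \<le> n then c k else 0)" for k
  have sub: "{k. c' k \<noteq> 0} \<subseteq> {..n}"
    by (auto simp: c'_def)
  then have c': "\<And>k. c' k \<in> sym_pow G k" "finite {k. c' k \<noteq> 0}" "f = (\<Sum>k | c' k \<noteq> 0. c' k)"
    using c finite_subset[OF sub]
    unfolding sum_nonzero_eq_sum_atMost[OF sub] by (simp_all add: c'_def f sym_pow_zero)
  then have "hom_part G f = c'"
    by (rule hom_part_eqI)
  then show "hom_part G f k \<in> sym_pow G k" "finite {k. hom_part G f k \<noteq> 0}"
      "f = (\<Sum>k | hom_part G f k \<noteq> 0. hom_part G f k)"
    using c' by simp_all
qed

definition inv_sym_pow :: "'g lie_group \<Rightarrow> nat \<Rightarrow> ('g vec \<Rightarrow> real) set" where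
  "inv_sym_pow G k = {f \<in> sym_pow G k. \<forall>g\<in>carrier G. \<forall>X\<in>lie_algebra G. f (Ad G g X) = f X}"

lemma add_subgroup_inv_sym_pow: "add_subgroup (inv_sym_pow G k)"
  using add_subgroup_sym_pow[of G k] by (auto simp: add_subgroup_def inv_sym_pow_def)

lemma Ad_scale: "Ad G g (\<lambda>h. t * X h) = (\<lambda>h. t * Ad G g X h)"
  by (auto simp: Ad_def)

text \<open>\<open>Ad\<close> commutes with scaling, so invariance of \<open>f\<close> at all \<open>t X\<close> is an identity of polynomials
  in \<open>t\<close>, and comparison of coefficients gives the invariance of each component. Homogeneity
  is applied at \<open>Ad G g X\<close> in the form that holds on all of the ambient type.\<close>

lemma inv_polys_hom_part:
  assumes "f \<in> carrier (inv_polys G)"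
  shows "hom_part G f k \<in> inv_sym_pow G k"
proof -
  let ?c = "hom_part G f"
  have poly: "f \<in> polys G" and inv: "\<And>g X. g \<in> carrier G \<Longrightarrow> X \<in> lie_algebra G \<Longrightarrow> f (Ad G g X) = f X"
    using assms by (auto simp: inv_polys_def)
  note c = polys_hom_part[OF poly]
  obtain N where N: "{k. ?c k \<noteq> 0} \<subseteq> {..N}"
    using c(2) finite_nat_iff_bounded_le by meson
  then have f: "f = (\<Sum>k\<le>N. ?c k)"
    using c(3) sum_nonzero_eq_sum_atMost by metis
  have "?c k (Ad G g X) = ?c k X" if "g \<in> carrier G" "X \<in> lie_algebra G" for g X
  proof (cases "k \<le> N")
    case True
    have "(\<Sum>k\<le>N. t ^ k * ?c k (Ad G g X)) = (\<Sum>k\<le>N. t ^ k * ?c k X)" if "t \<noteq> 0" for t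
      using inv[OF \<open>g \<in> carrier G\<close> lie_algebra_scale[OF \<open>X \<in> lie_algebra G\<close>, of t]]
        sum_sym_pow_scale[OF c(1) that, of N] f by (simp add: Ad_scale)
    from poly_coeffs_eq_of_nonzero[OF this True] show ?thesis .
  next
    case False
    then have "?c k = 0"
      using N by auto
    then show ?thesis
      by simp
  qed
  then show ?thesis
    using c(1) by (simp add: inv_sym_pow_def)
qed

lemma inv_polysI:
  assumes c: "\<And>k. c k \<in> inv_sym_pow G k" and fin: "finite {k. c k \<noteq> 0}"
  shows "(\<Sum>k | c k \<noteq> 0. c k) \<in> carrier (inv_polys G)"
    and "hom_part G (\<Sum>k | c k \<noteq> 0. c k) = c"
proof -
  obtain N where N: "{k. c k \<noteq> 0} \<subseteq> {..N}"
    using fin finite_nat_iff_bounded_le by meson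
  have sym: "\<And>k. c k \<in> sym_pow G k"
    using c by (simp add: inv_sym_pow_def)
  then show "hom_part G (\<Sum>k | c k \<noteq> 0. c k) = c"
    using fin by (intro hom_part_eqI) auto
  show "(\<Sum>k | c k \<noteq> 0. c k) \<in> carrier (inv_polys G)"
    unfolding sum_nonzero_eq_sum_atMost[OF N] using sym c
    by (auto simp: inv_polys_def polys_def inv_sym_pow_def sum_fun_apply)
qed


section \<open>The Cartan complex as a filtered differential module\<close>

lemma add_subgroup_sym_forms: "add_subgroup (sym_forms G M k q)"
  unfolding add_subgroup_def
proof (intro conjI ballI)
  show "0 \<in> sym_forms G M k q"
    unfolding sym_forms_def by (intro CollectI exI[of _ 0]) (simp add: fun_eq_iff)
  fix \<omega> \<eta> assume "\<omega> \<in> sym_forms G M k q" "\<eta> \<in> sym_forms G M k q"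
  then obtain n m :: nat and f w g v where
      f: "\<forall>j<n. f j \<in> sym_pow G k \<and> w j \<in> forms M q" "\<omega> = (\<lambda>X Vs p. \<Sum>j<n. f j X * w j Vs p)" and
      g: "\<forall>j<m. g j \<in> sym_pow G k \<and> v j \<in> forms M q" "\<eta> = (\<lambda>X Vs p. \<Sum>j<m. g j X * v j Vs p)"
    unfolding sym_forms_def by blast
  let ?h = "\<lambda>j. if j < n then f j else 0 - g (j - n)"
  let ?u = "\<lambda>j. if j < n then w j else v (j - n)"
  have "\<forall>j<n + m. ?h j \<in> sym_pow G k \<and> ?u j \<in> forms M q"
  proof (intro allI impI)
    fix j assume "j < n + m"
    then show "?h j \<in> sym_pow G k \<and> ?u j \<in> forms M q"
      using f(1) g(1) by (simp add: add_subgroup_diff[OF add_subgroup_sym_pow sym_pow_zero] del: diff_0)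
  qed
  moreover have "\<omega> - \<eta> = (\<lambda>X Vs p. \<Sum>j<n + m. ?h j X * ?u j Vs p)"
  proof (intro ext)
    fix X Vs p
    have "(\<omega> - \<eta>) X Vs p =
        (\<Sum>j<n + m. if j < n then f j X * w j Vs p else - (g (j - n) X * v (j - n) Vs p))"
      using sum_lessThan_append[where n = n and m = m and f = "\<lambda>j. f j X * w j Vs p"
          and g = "\<lambda>j. - (g j X * v j Vs p)"]
      by (simp add: f g sum_negf)
    also have "\<dots> = (\<Sum>j<n + m. ?h j X * ?u j Vs p)"
      by (intro sum.cong) auto
    finally show "(\<omega> - \<eta>) X Vs p = \<dots>" .
  qed
  ultimately show "\<omega> - \<eta> \<in> sym_forms G M k q"
    unfolding sym_forms_def by (intro CollectI exI[of _ "n + m"] exI[of _ ?h] exI[of _ ?u] conjI)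
qed

lemma pmult_sym_forms:
  assumes "h \<in> sym_pow G m" and "\<omega> \<in> sym_forms G M k q"
  shows "pmult h \<omega> \<in> sym_forms G M (k + m) q"
proof -
  obtain n :: nat and f w where
      f: "\<forall>j<n. f j \<in> sym_pow G k \<and> w j \<in> forms M q" "\<omega> = (\<lambda>X Vs p. \<Sum>j<n. f j X * w j Vs p)"
    using assms(2) unfolding sym_forms_def by blast
  then have "\<forall>j<n. f j * h \<in> sym_pow G (k + m) \<and> w j \<in> forms M q"
    using assms(1) by (simp add: sym_pow_mult)
  moreover have "pmult h \<omega> = (\<lambda>X Vs p. \<Sum>j<n. (f j * h) X * w j Vs p)"
    by (simp add: f pmult_def fun_eq_iff sum_distrib_left algebra_simps)
  ultimately show ?thesis
    unfolding sym_forms_def by (intro CollectI exI[of _ n] exI[of _ "\<lambda>j. f j * h"] exI[of _ w] conjI)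
qed

lemma sym_forms_smooth_valued:
  assumes "smooth_manifold M"
  shows "sym_forms G M k q \<subseteq> smooth_valued M"
proof
  fix \<omega> assume "\<omega> \<in> sym_forms G M k q"
  then obtain n :: nat and f w where
      f: "\<forall>j<n. f j \<in> sym_pow G k \<and> w j \<in> forms M q" "\<omega> = (\<lambda>X Vs p. \<Sum>j<n. f j X * w j Vs p)"
    unfolding sym_forms_def by blast
  have w: "w j Vs \<in> Cinf M" if "j < n" for j Vs
  proof -
    have "if length Vs = q \<and> set Vs \<subseteq> vfields M then w j Vs \<in> Cinf M else w j Vs = 0"
      using f(1) that unfolding forms_def by blast
    then show ?thesis
      by (metis Cinf_zero)
  qed
  have "\<omega> X Vs \<in> Cinf M" for X Vs
  proof -
    have "\<omega> X Vs = (\<Sum>j<n. (\<lambda>_. f j X) * w j Vs)"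
      by (simp add: f fun_eq_iff sum_fun_apply)
    then show ?thesis
      using w by (auto intro!: Cinf_sum[OF assms])
  qed
  then show "\<omega> \<in> smooth_valued M"
    by (simp add: smooth_valued_def)
qed

lemma pull_form_diff: "pull_form M a (w - v) = pull_form M a w - pull_form M a v"
  by (simp add: pull_form_def fcomp_def fun_eq_iff)

lemma pull_form_zero: "pull_form M a 0 = 0"
  by (simp add: pull_form_def fcomp_def fun_eq_iff)

lemma pull_form_cmult: "pull_form M a (\<lambda>Vs p. c * w Vs p) = (\<lambda>Vs p. c * pull_form M a w Vs p)"
  by (simp add: pull_form_def fcomp_def fun_eq_iff)

lemma add_subgroup_Cbi: "add_subgroup (Cbi G M \<phi> l q)"
  using add_subgroup_sym_forms[of G M "nat l div 2" "nat q"]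
  by (simp add: add_subgroup_def Cbi_def pull_form_diff pull_form_zero)

lemma Cbi_smooth_valued: "smooth_manifold M \<Longrightarrow> Cbi G M \<phi> l q \<subseteq> smooth_valued M"
  using sym_forms_smooth_valued[of M G] zero_smooth_valued by (auto simp: Cbi_def)

lemma pmult_Cbi:
  assumes "f \<in> inv_sym_pow G k" and "\<omega> \<in> Cbi G M \<phi> l q"
  shows "pmult f \<omega> \<in> Cbi G M \<phi> (l + 2 * int k) q"
proof (cases "0 \<le> l \<and> even l \<and> 0 \<le> q")
  case True
  then have eq: "nat (l + 2 * int k) div 2 = nat l div 2 + k"
    by (auto elim!: evenE)
  have \<omega>: "\<omega> \<in> sym_forms G M (nat l div 2) (nat q)"
      "\<And>g X. g \<in> carrier G \<Longrightarrow> X \<in> lie_algebra G \<Longrightarrow>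
         \<omega> (Ad G g X) = pull_form M (\<phi> (inv\<^bsub>G\<^esub> g)) (\<omega> X)"
    using assms(2) True by (auto simp: Cbi_def)
  have "pmult f \<omega> \<in> sym_forms G M (nat l div 2 + k) (nat q)"
    using assms(1) \<omega>(1) by (simp add: pmult_sym_forms inv_sym_pow_def)
  moreover have "pmult f \<omega> (Ad G g X) = pull_form M (\<phi> (inv\<^bsub>G\<^esub> g)) (pmult f \<omega> X)"
    if "g \<in> carrier G" "X \<in> lie_algebra G" for g X
    using that assms(1) \<omega>(2) by (simp add: pmult_def pull_form_cmult inv_sym_pow_def)
  ultimately show ?thesis
    using True by (simp add: Cbi_def eq)
next
  case False
  then have "\<omega> = 0"
    using assms(2) by (auto simp: Cbi_def split: if_splits)
  then show ?thesis
    by (simp add: add_subgroup_zero[OF add_subgroup_Cbi])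
qed

lemma add_subgroup_FC: "add_subgroup (FC G M \<phi> p n)"
  unfolding FC_def by (intro add_subgroup_set_sum add_subgroup_Cbi) auto

lemma FC_smooth_valued:
  assumes "smooth_manifold M"
  shows "FC G M \<phi> p n \<subseteq> smooth_valued M"
proof
  fix \<omega> assume "\<omega> \<in> FC G M \<phi> p n"
  then obtain s where \<omega>: "\<omega> = (\<Sum>l\<in>{p..n}. s l)" and s: "\<forall>l\<in>{p..n}. s l \<in> Cbi G M \<phi> l (n - l)"
    unfolding FC_def by (auto simp: set_sum_alt)
  have "s l \<in> smooth_valued M" if "l \<in> {p..n}" for l
    using s that by (intro subsetD[OF Cbi_smooth_valued[OF assms]]) blast
  then show "\<omega> \<in> smooth_valued M"
    unfolding \<omega> by (rule smooth_valued_sum[OF assms])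
qed

lemma pmult_FC:
  assumes "f \<in> inv_sym_pow G k" and "\<omega> \<in> FC G M \<phi> p n"
  shows "pmult f \<omega> \<in> FC G M \<phi> (p + 2 * int k) (n + 2 * int k)"
proof -
  obtain s where \<omega>: "\<omega> = (\<Sum>l\<in>{p..n}. s l)" and s: "\<And>l. l \<in> {p..n} \<Longrightarrow> s l \<in> Cbi G M \<phi> l (n - l)"
    using assms(2) unfolding FC_def by (auto simp: set_sum_alt)
  let ?t = "\<lambda>l. pmult f (s (l - 2 * int k))"
  have "pmult f \<omega> = (\<Sum>l\<in>{p + 2 * int k..n + 2 * int k}. ?t l)"
    unfolding \<omega> pmult_sum_right
    by (rule sum.reindex_bij_witness[of _ "\<lambda>l. l - 2 * int k" "\<lambda>l. l + 2 * int k"]) auto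
  moreover have "?t l \<in> Cbi G M \<phi> l (n + 2 * int k - l)" if "l \<in> {p + 2 * int k..n + 2 * int k}" for l
    using pmult_Cbi[OF assms(1) s[of "l - 2 * int k"]] that by (simp add: algebra_simps)
  ultimately show ?thesis
    unfolding FC_def by (auto simp: set_sum_alt)
qed

lemma FC_mono:
  assumes "p \<le> p'"
  shows "FC G M \<phi> p' n \<subseteq> FC G M \<phi> p n"
proof
  fix \<omega> assume "\<omega> \<in> FC G M \<phi> p' n"
  then obtain s where \<omega>: "\<omega> = (\<Sum>l\<in>{p'..n}. s l)" and s: "\<And>l. l \<in> {p'..n} \<Longrightarrow> s l \<in> Cbi G M \<phi> l (n - l)"
    unfolding FC_def by (auto simp: set_sum_alt)
  let ?t = "\<lambda>l. if p' \<le> l then s l else 0"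
  have "\<omega> = (\<Sum>l\<in>{p..n}. ?t l)"
    unfolding \<omega> using assms by (intro sum.mono_neutral_cong_left) auto
  moreover have "?t l \<in> Cbi G M \<phi> l (n - l)" if "l \<in> {p..n}" for l
    using s that by (simp add: add_subgroup_zero[OF add_subgroup_Cbi])
  ultimately show "\<omega> \<in> FC G M \<phi> p n"
    unfolding FC_def by (simp only: set_sum_alt finite_atLeastAtMost_int) blast
qed

text \<open>The filtration is exhausted at \<open>p = 0\<close>; the summands of negative index are zero.\<close>

lemma FC_nonpos:
  assumes "p \<le> 0"
  shows "FC G M \<phi> p n = CG G M \<phi> n"
proof
  show "FC G M \<phi> p n \<subseteq> CG G M \<phi> n"
  proof
    fix \<omega> assume "\<omega> \<in> FC G M \<phi> p n"
    then obtain s where \<omega>: "\<omega> = (\<Sum>l\<in>{p..n}. s l)" and s: "\<And>l. l \<in> {p..n} \<Longrightarrow> s l \<in> Cbi G M \<phi> l (n - l)"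
      unfolding FC_def by (auto simp: set_sum_alt)
    have "\<omega> = (\<Sum>l\<in>{0..n}. s l)"
      unfolding \<omega> using assms s by (intro sum.mono_neutral_right) (fastforce simp: Cbi_def)+
    then show "\<omega> \<in> CG G M \<phi> n"
      using s assms unfolding FC_def
      by (simp only: set_sum_alt finite_atLeastAtMost_int) fastforce
  qed
qed (rule FC_mono[OF assms])

lemma FC_subset_CG: "FC G M \<phi> p n \<subseteq> CG G M \<phi> n"
proof (cases "p \<le> 0")
  case True
  then show ?thesis
    by (rule equalityD1[OF FC_nonpos])
next
  case False
  then show ?thesis
    by (intro FC_mono) simp
qed

lemma FC_above_degree: "n < p \<Longrightarrow> FC G M \<phi> p n = {0}"
  by (simp add: FC_def)

lemma add_subgroup_BG:
  assumes "smooth_manifold M"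
  shows "add_subgroup (BG G M \<phi> n)"
  unfolding add_subgroup_def
proof (intro conjI ballI)
  show "0 \<in> BG G M \<phi> n"
    unfolding BG_def using add_subgroup_zero[OF add_subgroup_FC] assms
    by (intro image_eqI[of _ _ 0]) simp_all
  fix a b assume "a \<in> BG G M \<phi> n" "b \<in> BG G M \<phi> n"
  then obtain \<alpha> \<beta> where ab: "\<alpha> \<in> CG G M \<phi> (n - 1)" "a = dG G M \<phi> \<alpha>"
      "\<beta> \<in> CG G M \<phi> (n - 1)" "b = dG G M \<phi> \<beta>"
    unfolding BG_def by blast
  note sv = subsetD[OF FC_smooth_valued[OF assms]]
  have "\<alpha> - \<beta> \<in> CG G M \<phi> (n - 1)" "a - b = dG G M \<phi> (\<alpha> - \<beta>)"
    by (simp_all add: dG_diff[OF assms sv[OF ab(1)] sv[OF ab(3)]] ab add_subgroup_diff[OF add_subgroup_FC])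
  then show "a - b \<in> BG G M \<phi> n"
    unfolding BG_def by blast
qed

lemma pmult_BG:
  assumes "smooth_manifold M" and "f \<in> inv_sym_pow G k" and "b \<in> BG G M \<phi> n"
  shows "pmult f b \<in> BG G M \<phi> (n + 2 * int k)"
proof -
  obtain \<beta> where \<beta>: "\<beta> \<in> CG G M \<phi> (n - 1)" "b = dG G M \<phi> \<beta>"
    using assms(3) unfolding BG_def by blast
  then have "pmult f b = dG G M \<phi> (pmult f \<beta>)"
    using dG_pmult[OF assms(1) subsetD[OF FC_smooth_valued[OF assms(1)] \<beta>(1)]] by simp
  moreover have "pmult f \<beta> \<in> CG G M \<phi> (n + 2 * int k - 1)"
    using subsetD[OF FC_subset_CG pmult_FC[OF assms(2) \<beta>(1)]] by (simp add: algebra_simps)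
  ultimately show ?thesis
    unfolding BG_def by blast
qed

text \<open>The cocycles of degree \<open>n\<close> in the \<open>p\<close>-th step of the filtration. They represent \<open>F\<^sup>pH\<^sup>n\<close>,
  and also the whole of the final page in bidegree \<open>(p, n - p)\<close>.\<close>

definition cocycles :: "'g lie_group \<Rightarrow> 'm mfd \<Rightarrow> ('g \<Rightarrow> 'm \<Rightarrow> 'm) \<Rightarrow> int \<Rightarrow> int \<Rightarrow> ('g, 'm) cochain set"
  where "cocycles G M \<phi> p n = {z \<in> FC G M \<phi> p n. dG G M \<phi> z = 0}"

lemma add_subgroup_cocycles:
  assumes "smooth_manifold M"
  shows "add_subgroup (cocycles G M \<phi> p n)"
proof -
  have "dG G M \<phi> (a - b) = dG G M \<phi> a - dG G M \<phi> b" if "a \<in> FC G M \<phi> p n" "b \<in> FC G M \<phi> p n" for a b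
    using that by (meson dG_diff[OF assms] FC_smooth_valued[OF assms] subsetD)
  then show ?thesis
    using add_subgroup_FC[of G M \<phi> p n] assms
    by (simp add: add_subgroup_def cocycles_def)
qed

lemma pmult_cocycles:
  assumes "smooth_manifold M" and "f \<in> inv_sym_pow G k" and "z \<in> cocycles G M \<phi> p n"
  shows "pmult f z \<in> cocycles G M \<phi> (p + 2 * int k) (n + 2 * int k)"
proof -
  have "dG G M \<phi> (pmult f z) = pmult f (dG G M \<phi> z)"
    using assms(3) FC_smooth_valued[OF assms(1), of G \<phi> p n]
    by (intro dG_pmult[OF assms(1)]) (auto simp: cocycles_def)
  then show ?thesis
    using assms(3) by (simp add: cocycles_def pmult_FC[OF assms(2)])
qed

lemma cocycles_mono: "p \<le> p' \<Longrightarrow> cocycles G M \<phi> p' n \<subseteq> cocycles G M \<phi> p n"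
  using FC_mono by (fastforce simp: cocycles_def)


section \<open>Graded quotient modules\<close>

lemma mem_coset_iff: "c \<in> a +o B \<longleftrightarrow> c - a \<in> B"
  for a :: "'a::ab_group_add"
  by (metis add_diff_cancel_left' diff_add_cancel add.commute set_minus_plus)

context
  fixes B :: "'a::ab_group_add set"
  assumes B: "add_subgroup B"
begin

lemma coset_eq_iff: "a +o B = b +o B \<longleftrightarrow> a - b \<in> B"
proof
  assume "a +o B = b +o B"
  moreover have "a \<in> a +o B"
    by (simp add: mem_coset_iff add_subgroup_zero[OF B])
  ultimately show "a - b \<in> B"
    by (simp add: mem_coset_iff)
next
  assume ab: "a - b \<in> B"
  have "c - a \<in> B \<longleftrightarrow> c - b \<in> B" for c
    using add_subgroup_add[OF B _ ab, of "c - a"] add_subgroup_diff[OF B _ ab, of "c - b"] by auto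
  then show "a +o B = b +o B"
    by (auto simp: mem_coset_iff)
qed

lemma coset_zero: "0 +o B = B"
  by (auto simp: mem_coset_iff)

lemma coset_eq_subgroup_iff: "a +o B = B \<longleftrightarrow> a \<in> B"
  using coset_eq_iff[of a 0] by (simp add: coset_zero)

text \<open>The form in which sums of cosets occur in \<open>graded_module\<close>: the summands need only be nonempty
  parts of cosets, such as the images of cosets under multiplication by a polynomial, and the
  single summand \<open>B\<close> fills up the result to a full coset.\<close>

lemma coset_sum:
  assumes "finite K" and "\<And>k. k \<in> K \<Longrightarrow> S k \<noteq> {}" and "\<And>k. k \<in> K \<Longrightarrow> S k \<subseteq> s k +o B"
  shows "(\<Sum>k\<in>K. S k) + B = (\<Sum>k\<in>K. s k) +o B"
proof -
  have diff: "(\<Sum>k\<in>K. t k) - (\<Sum>k\<in>K. s k) \<in> B" if "\<forall>k\<in>K. t k \<in> S k" for t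
  proof -
    have "(\<Sum>k\<in>K. t k - s k) \<in> B"
    proof (rule add_subgroup_sum[OF B])
      fix k assume "k \<in> K"
      then have "t k \<in> s k +o B"
        using that assms(3) by blast
      then show "t k - s k \<in> B"
        by (simp add: mem_coset_iff)
    qed
    then show ?thesis
      by (simp add: sum_subtractf)
  qed
  show ?thesis
  proof (intro equalityI subsetI)
    fix c assume "c \<in> (\<Sum>k\<in>K. S k) + B"
    then obtain t b where t: "\<forall>k\<in>K. t k \<in> S k" and "b \<in> B" "c = sum t K + b"
      unfolding set_plus_def set_sum_alt[OF assms(1)] by blast
    moreover from this have "(sum t K - sum s K) + b \<in> B"
      by (intro add_subgroup_add[OF B] diff)
    moreover have "(sum t K + b) - sum s K = (sum t K - sum s K) + b"
      by simp
    ultimately show "c \<in> sum s K +o B"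
      by (simp only: mem_coset_iff)
  next
    fix c assume c: "c \<in> sum s K +o B"
    have "\<forall>k\<in>K. \<exists>u. u \<in> S k"
      using assms(2) by blast
    then obtain t where t: "\<forall>k\<in>K. t k \<in> S k"
      by metis
    have "(c - sum s K) - (sum t K - sum s K) \<in> B"
      using c by (intro add_subgroup_diff[OF B _ diff[OF t]]) (simp add: mem_coset_iff)
    then have "c - sum t K \<in> B"
      by simp
    moreover have "c = sum t K + (c - sum t K)"
      by simp
    ultimately show "c \<in> (\<Sum>k\<in>K. S k) + B"
      unfolding set_plus_def set_sum_alt[OF assms(1)] using t by blast
  qed
qed

lemma coset_add: "(a +o B) + (b +o B) = (a + b) +o B"
proof (intro equalityI subsetI)
  fix c assume "c \<in> (a +o B) + (b +o B)"
  then obtain u v where "u - a \<in> B" "v - b \<in> B" "c = u + v"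
    unfolding set_plus_def by (auto simp: mem_coset_iff)
  moreover from this have "(u - a) + (v - b) \<in> B"
    by (intro add_subgroup_add[OF B])
  moreover have "(u + v) - (a + b) = (u - a) + (v - b)"
    by simp
  ultimately show "c \<in> (a + b) +o B"
    by (simp only: mem_coset_iff)
next
  fix c assume "c \<in> (a + b) +o B"
  then have "c - a \<in> b +o B" "a \<in> a +o B" "c = a + (c - a)"
    by (simp_all add: mem_coset_iff add_subgroup_zero[OF B] diff_diff_eq)
  then show "c \<in> (a +o B) + (b +o B)"
    unfolding set_plus_def by blast
qed

end

text \<open>The common structure of \<open>H\<^sup>*\<^sub>G(M)\<close> and \<open>E\<^sub>\<infinity>\<close>: the component of index \<open>i\<close> consists of the cosets of
  \<open>B i\<close> that meet \<open>Z i\<close>. The last two assumptions make any two of an index, a degree \<open>m\<close> and the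
  index shifted by \<open>m\<close> determine the third; this keeps finite supports finite and separates the
  contributions of the components of a polynomial.\<close>

locale graded_quotient =
  fixes G :: "'g lie_group" and Z B :: "'i \<Rightarrow> ('g, 'm) cochain set" and sh :: "nat \<Rightarrow> 'i \<Rightarrow> 'i"
  assumes subgroup_Z: "add_subgroup (Z i)"
    and subgroup_B: "add_subgroup (B i)"
    and pmult_Z: "f \<in> inv_sym_pow G m \<Longrightarrow> z \<in> Z (sh m i) \<Longrightarrow> pmult f z \<in> Z i"
    and pmult_B: "f \<in> inv_sym_pow G m \<Longrightarrow> b \<in> B (sh m i) \<Longrightarrow> pmult f b \<in> B i"
    and inj_sh: "sh m i = sh m j \<Longrightarrow> i = j"
    and inj_degree: "sh m i = sh m' i \<Longrightarrow> m = m'"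
begin

definition quot :: "('g vec \<Rightarrow> real, 'i \<Rightarrow> ('g, 'm) cochain set) module" where
  "quot = graded_module G (\<lambda>i. {z +o B i | z. z \<in> Z i}) B sh"

definition represents :: "('i \<Rightarrow> ('g, 'm) cochain) \<Rightarrow> ('i \<Rightarrow> ('g, 'm) cochain set) \<Rightarrow> bool" where
  "represents z e \<longleftrightarrow> (\<forall>i. z i \<in> Z i \<and> e i = z i +o B i)"

lemma carrier_quot_iff:
  "e \<in> carrier quot \<longleftrightarrow> (\<exists>z. represents z e) \<and> finite {i. e i \<noteq> B i}"
proof -
  have "(\<forall>i. e i \<in> {z +o B i | z. z \<in> Z i}) \<longleftrightarrow> (\<exists>z. represents z e)"
    unfolding represents_def mem_Collect_eq by metis
  then show ?thesis
    by (simp add: quot_def graded_module_def)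
qed

lemma zero_quot: "\<zero>\<^bsub>quot\<^esub> = B"
  and add_quot: "e \<oplus>\<^bsub>quot\<^esub> e' = (\<lambda>i. e i + e' i)"
  by (simp_all add: quot_def graded_module_def)

lemma represents_zero: "represents (\<lambda>_. 0) B"
  by (simp add: represents_def add_subgroup_zero[OF subgroup_Z] coset_zero[OF subgroup_B])

lemma represents_add:
  "represents z e \<Longrightarrow> represents z' e' \<Longrightarrow> represents (\<lambda>i. z i + z' i) (\<lambda>i. e i + e' i)"
  by (simp add: represents_def add_subgroup_add[OF subgroup_Z] coset_add[OF subgroup_B])

lemma subgroup_plus_subgroup: "B i + B i = B i"
  using coset_add[OF subgroup_B[of i], of 0 0] by (simp add: coset_zero[OF subgroup_B])

lemma abelian_monoid_quot: "abelian_monoid quot"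
proof (rule abelian_monoidI)
  fix e e' assume "e \<in> carrier quot" "e' \<in> carrier quot"
  then obtain z z' where z: "represents z e" "represents z' e'"
      and fin: "finite ({i. e i \<noteq> B i} \<union> {i. e' i \<noteq> B i})"
    unfolding carrier_quot_iff by blast
  have "{i. e i + e' i \<noteq> B i} \<subseteq> {i. e i \<noteq> B i} \<union> {i. e' i \<noteq> B i}"
    by (auto simp: subgroup_plus_subgroup)
  then show "e \<oplus>\<^bsub>quot\<^esub> e' \<in> carrier quot"
    unfolding carrier_quot_iff add_quot using represents_add[OF z] finite_subset[OF _ fin] by blast
next
  show "\<zero>\<^bsub>quot\<^esub> \<in> carrier quot"
    unfolding carrier_quot_iff zero_quot using represents_zero by auto
next
  fix e assume "e \<in> carrier quot"
  then obtain z where "represents z e"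
    unfolding carrier_quot_iff by blast
  then have "B i + e i = e i" for i
    using coset_add[OF subgroup_B[of i], of 0 "z i"]
    by (simp add: represents_def coset_zero[OF subgroup_B])
  then show "\<zero>\<^bsub>quot\<^esub> \<oplus>\<^bsub>quot\<^esub> e = e"
    by (simp add: add_quot zero_quot)
qed (simp_all add: add_quot ac_simps)

lemma finsum_quot:
  assumes "finite I" and "\<And>i. i \<in> I \<Longrightarrow> v i \<in> carrier quot"
    and "\<And>i. i \<in> I \<Longrightarrow> represents (w i) (v i)"
  shows "represents (\<lambda>j. \<Sum>i\<in>I. w i j) (\<Oplus>\<^bsub>quot\<^esub>i\<in>I. v i)"
  using assms
proof (induction I rule: finite_induct)
  case empty
  show ?case
    by (simp only: sum.empty abelian_monoid.finsum_empty[OF abelian_monoid_quot] zero_quot represents_zero)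
next
  case (insert i I)
  have "(\<Oplus>\<^bsub>quot\<^esub>i\<in>insert i I. v i) = v i \<oplus>\<^bsub>quot\<^esub> (\<Oplus>\<^bsub>quot\<^esub>i\<in>I. v i)"
    using insert by (intro abelian_monoid.finsum_insert[OF abelian_monoid_quot]) auto
  moreover have "represents (\<lambda>j. w i j + (\<Sum>i\<in>I. w i j)) (v i \<oplus>\<^bsub>quot\<^esub> (\<Oplus>\<^bsub>quot\<^esub>i\<in>I. v i))"
    unfolding add_quot using insert by (intro represents_add) auto
  moreover have "(\<Sum>i\<in>insert i I. w i j) = w i j + (\<Sum>i\<in>I. w i j)" for j
    using insert by simp
  ultimately show ?case
    by (simp only:)
qed

lemma smult_quot:
  assumes "a \<in> carrier (inv_polys G)" and "e \<in> carrier quot" and "represents z e"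
  shows "a \<odot>\<^bsub>quot\<^esub> e \<in> carrier quot"
    and "represents (\<lambda>i. \<Sum>m | hom_part G a m \<noteq> 0. pmult (hom_part G a m) (z (sh m i))) (a \<odot>\<^bsub>quot\<^esub> e)"
proof -
  let ?h = "hom_part G a"
  let ?K = "{m. ?h m \<noteq> 0}"
  note h = inv_polys_hom_part[OF assms(1)]
  have finK: "finite ?K"
    using assms(1) polys_hom_part(2) by (auto simp: inv_polys_def)
  have smult: "(a \<odot>\<^bsub>quot\<^esub> e) i = (\<Sum>m\<in>?K. pmult (?h m) ` e (sh m i)) + B i" for i
    by (simp add: quot_def graded_module_def)
  have z: "z i \<in> Z i" "e i = z i +o B i" for i
    using assms(3) by (auto simp: represents_def)
  have coset: "pmult (?h m) ` (w +o B (sh m i)) \<subseteq> pmult (?h m) w +o B i" for m w i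
  proof -
    have "pmult (?h m) c - pmult (?h m) w \<in> B i" if "c - w \<in> B (sh m i)" for c
      using pmult_B[OF h that] by (simp add: pmult_minus_right)
    then show ?thesis
      by (auto simp: mem_coset_iff)
  qed
  have nonempty: "e i \<noteq> {}" for i
    using add_subgroup_zero[OF subgroup_B] z(2) by (metis empty_iff mem_coset_iff diff_self)
  have "(\<Sum>m\<in>?K. pmult (?h m) ` e (sh m i)) + B i = (\<Sum>m\<in>?K. pmult (?h m) (z (sh m i))) +o B i" for i
    using nonempty coset z(2) by (intro coset_sum[OF subgroup_B finK]) auto
  moreover have "(\<Sum>m\<in>?K. pmult (?h m) (z (sh m i))) \<in> Z i" for i
    by (intro add_subgroup_sum[OF subgroup_Z] pmult_Z[OF h] z(1))
  ultimately show rep: "represents (\<lambda>i. \<Sum>m\<in>?K. pmult (?h m) (z (sh m i))) (a \<odot>\<^bsub>quot\<^esub> e)"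
    by (simp add: represents_def smult)
  have "{i. (a \<odot>\<^bsub>quot\<^esub> e) i \<noteq> B i} \<subseteq> (\<Union>m\<in>?K. sh m -` {i. e i \<noteq> B i})"
  proof (rule ccontr)
    assume "\<not> ?thesis"
    then obtain i where i: "(a \<odot>\<^bsub>quot\<^esub> e) i \<noteq> B i" "\<forall>m\<in>?K. e (sh m i) = B (sh m i)"
      by auto
    have "pmult (?h m) ` e (sh m i) \<subseteq> 0 +o B i" if "m \<in> ?K" for m
      using coset[of m 0 i] i(2) that by (simp add: coset_zero[OF subgroup_B])
    then have "(a \<odot>\<^bsub>quot\<^esub> e) i = (\<Sum>m\<in>?K. 0) +o B i"
      unfolding smult using nonempty by (intro coset_sum[OF subgroup_B finK]) auto
    then show False
      using i(1) by (simp add: coset_zero[OF subgroup_B])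
  qed
  moreover have "finite (sh m -` {i. e i \<noteq> B i})" for m
    using assms(2) inj_sh by (intro finite_vimageI) (auto simp: carrier_quot_iff inj_def)
  ultimately have "finite {i. (a \<odot>\<^bsub>quot\<^esub> e) i \<noteq> B i}"
    using finK by (meson finite_UN finite_subset)
  then show "a \<odot>\<^bsub>quot\<^esub> e \<in> carrier quot"
    using rep carrier_quot_iff by blast
qed

lemma homog_quot:
  assumes "z \<in> Z n"
  shows "homog quot n (z +o B n) \<in> carrier quot"
    and "represents (\<lambda>j. if j = n then z else 0) (homog quot n (z +o B n))"
proof -
  show rep: "represents (\<lambda>j. if j = n then z else 0) (homog quot n (z +o B n))"
    using assms by (simp add: represents_def homog_def zero_quot add_subgroup_zero[OF subgroup_Z]
        coset_zero[OF subgroup_B])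
  have "{i. homog quot n (z +o B n) i \<noteq> B i} \<subseteq> {n}"
    by (auto simp: homog_def zero_quot)
  then show "homog quot n (z +o B n) \<in> carrier quot"
    unfolding carrier_quot_iff using rep finite_subset by blast
qed

text \<open>The only component of a polynomial that maps index \<open>n\<close> to index \<open>j\<close>, if there is one.\<close>

definition component_at :: "(nat \<Rightarrow> 'g vec \<Rightarrow> real) \<Rightarrow> 'i \<Rightarrow> 'i \<Rightarrow> 'g vec \<Rightarrow> real" where
  "component_at c j n = (if \<exists>m. sh m j = n then c (THE m. sh m j = n) else 0)"

lemma component_at_eq: "sh m j = n \<Longrightarrow> component_at c j n = c m"
proof -
  assume m: "sh m j = n"
  then have "(THE m. sh m j = n) = m"
    using inj_degree by (intro the_equality) auto
  then show ?thesis
    using m by (auto simp: component_at_def)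
qed

lemma sum_components:
  assumes "finite {m. c m \<noteq> 0}"
  shows "(\<Sum>m | c m \<noteq> 0. pmult (c m) (if sh m j = n then z else 0)) = pmult (component_at c j n) z"
proof (cases "\<exists>m. sh m j = n")
  case True
  then obtain m where m: "sh m j = n"
    by blast
  then have eq: "sh m' j = n \<longleftrightarrow> m' = m" for m'
    using inj_degree by metis
  have "(\<Sum>m | c m \<noteq> 0. pmult (c m) (if sh m j = n then z else 0)) =
      (\<Sum>m' | c m' \<noteq> 0. if m' = m then pmult (c m) z else 0)"
    unfolding eq by (intro sum.cong) auto
  also have "\<dots> = (if m \<in> {m. c m \<noteq> 0} then pmult (c m) z else 0)"
    using assms by (simp only: sum.delta)
  also have "\<dots> = pmult (c m) z"
    by auto
  finally show ?thesis
    by (simp add: component_at_eq[OF m])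
next
  case False
  then have "pmult (c m) (if sh m j = n then z else 0) = 0" for m
    by auto
  then have "(\<Sum>m | c m \<noteq> 0. pmult (c m) (if sh m j = n then z else 0)) = 0"
    by (simp only: sum.neutral_const)
  then show ?thesis
    using False by (simp add: component_at_def)
qed

lemma combination_quot:
  fixes k :: nat
  assumes a: "\<And>i. i < k \<Longrightarrow> a i \<in> carrier (inv_polys G)" and z: "\<And>i. i < k \<Longrightarrow> z i \<in> Z (n i)"
    and x: "\<And>i. i < k \<Longrightarrow> x i = z i +o B (n i)"
  shows "(\<Oplus>\<^bsub>quot\<^esub>i\<in>{..<k}. a i \<odot>\<^bsub>quot\<^esub> homog quot (n i) (x i)) j =
    (\<Sum>i<k. pmult (component_at (hom_part G (a i)) j (n i)) (z i)) +o B j"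
proof -
  let ?v = "\<lambda>i. a i \<odot>\<^bsub>quot\<^esub> homog quot (n i) (x i)"
  let ?w = "\<lambda>i j. \<Sum>m | hom_part G (a i) m \<noteq> 0.
    pmult (hom_part G (a i) m) (if sh m j = n i then z i else 0)"
  have "represents (\<lambda>j. \<Sum>i<k. ?w i j) (\<Oplus>\<^bsub>quot\<^esub>i\<in>{..<k}. ?v i)"
  proof (rule finsum_quot)
    fix i assume "i \<in> {..<k}"
    then have i: "i < k"
      by simp
    show "?v i \<in> carrier quot" "represents (?w i) (?v i)"
      using smult_quot[OF a[OF i] homog_quot[OF z[OF i]]] by (auto simp: x[OF i])
  qed simp
  then have "(\<Oplus>\<^bsub>quot\<^esub>i\<in>{..<k}. ?v i) j = (\<Sum>i<k. ?w i j) +o B j"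
    by (simp add: represents_def)
  moreover have "?w i j = pmult (component_at (hom_part G (a i)) j (n i)) (z i)" if "i < k" for i
    using a[OF that] by (intro sum_components polys_hom_part(2)) (simp add: inv_polys_def)
  then have "(\<Sum>i<k. ?w i j) = (\<Sum>i<k. pmult (component_at (hom_part G (a i)) j (n i)) (z i))"
    by (intro sum.cong) auto
  ultimately show ?thesis
    by (simp only:)
qed

text \<open>The homogeneous coefficients that carry elements of index \<open>n\<close> to elements of index \<open>j\<close>.\<close>

definition coeffs :: "'i \<Rightarrow> 'i \<Rightarrow> ('g vec \<Rightarrow> real) set" where
  "coeffs j n = {f. f = 0 \<or> (\<exists>m. sh m j = n \<and> f \<in> inv_sym_pow G m)}"

lemma zero_coeffs: "0 \<in> coeffs j n"
  by (simp add: coeffs_def)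

lemma coeffs_add:
  assumes "f \<in> coeffs j n" and "g \<in> coeffs j n"
  shows "f + g \<in> coeffs j n"
proof (cases "f = 0 \<or> g = 0")
  case False
  then obtain m m' where "sh m j = n" "f \<in> inv_sym_pow G m" "sh m' j = n" "g \<in> inv_sym_pow G m'"
    using assms by (auto simp: coeffs_def)
  moreover from this have "m' = m"
    using inj_degree by metis
  ultimately have "f + g \<in> inv_sym_pow G m"
    by (simp add: add_subgroup_add[OF add_subgroup_inv_sym_pow])
  then show ?thesis
    using \<open>sh m j = n\<close> unfolding coeffs_def by blast
qed (use assms in auto)

text \<open>For homogeneous generators, generation can be tested on homogeneous elements and with
  homogeneous coefficients, and then it is a statement about representatives. In one direction
  one takes, of each coefficient, the component that reaches the index in question. In the other
  direction the coefficients found for the various indices \<open>j\<close> are added up; as different \<open>j\<close>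
  need components of different degrees, they do not interfere, and the sums are finite because
  the element has finite support.\<close>

lemma generates_quot_iff:
  fixes k :: nat
  assumes z: "\<And>i. i < k \<Longrightarrow> z i \<in> Z (n i)"
    and x: "\<And>i. i < k \<Longrightarrow> x i = z i +o B (n i)"
  shows "generates (inv_polys G) quot k (\<lambda>i. homog quot (n i) (x i)) \<longleftrightarrow>
    (\<forall>j. \<forall>c\<in>Z j. \<exists>f. (\<forall>i<k. f i \<in> coeffs j (n i)) \<and> c - (\<Sum>i<k. pmult (f i) (z i)) \<in> B j)"
proof (intro iffI allI ballI)
  fix j c
  assume gen: "generates (inv_polys G) quot k (\<lambda>i. homog quot (n i) (x i))"
    and c: "c \<in> Z j"
  then obtain a where a: "a \<in> {..<k} \<rightarrow> carrier (inv_polys G)" and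
      eq: "homog quot j (c +o B j) = (\<Oplus>\<^bsub>quot\<^esub>i\<in>{..<k}. a i \<odot>\<^bsub>quot\<^esub> homog quot (n i) (x i))"
    using homog_quot(1)[OF c] unfolding generates_def by blast
  let ?f = "\<lambda>i. component_at (hom_part G (a i)) j (n i)"
  have "c +o B j = homog quot j (c +o B j) j"
    by (simp add: homog_def)
  also have "\<dots> = (\<Sum>i<k. pmult (?f i) (z i)) +o B j"
    unfolding eq using a z x by (intro combination_quot) auto
  finally have "c - (\<Sum>i<k. pmult (?f i) (z i)) \<in> B j"
    using coset_eq_iff[OF subgroup_B] by blast
  moreover have "?f i \<in> coeffs j (n i)" if "i < k" for i
  proof (cases "\<exists>m. sh m j = n i")
    case True
    then obtain m where "sh m j = n i"
      by blast
    moreover have "hom_part G (a i) m \<in> inv_sym_pow G m"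
      using a that by (intro inv_polys_hom_part) auto
    ultimately show ?thesis
      by (auto simp: coeffs_def component_at_eq)
  next
    case False
    then show ?thesis
      by (simp add: component_at_def zero_coeffs)
  qed
  ultimately show "\<exists>f. (\<forall>i<k. f i \<in> coeffs j (n i)) \<and> c - (\<Sum>i<k. pmult (f i) (z i)) \<in> B j"
    by (intro exI[of _ ?f]) blast
next
  assume comb: "\<forall>j. \<forall>c\<in>Z j. \<exists>f. (\<forall>i<k. f i \<in> coeffs j (n i)) \<and> c - (\<Sum>i<k. pmult (f i) (z i)) \<in> B j"
  show "generates (inv_polys G) quot k (\<lambda>i. homog quot (n i) (x i))"
    unfolding generates_def
  proof (intro conjI allI impI ballI)
    fix i assume "i < k"
    then show "homog quot (n i) (x i) \<in> carrier quot"
      using homog_quot(1)[OF z] by (simp add: x)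
  next
    fix e assume "e \<in> carrier quot"
    then obtain w where w: "\<And>j. w j \<in> Z j" "\<And>j. e j = w j +o B j" and fin: "finite {j. e j \<noteq> B j}"
      unfolding carrier_quot_iff represents_def by blast
    \<comment> \<open>Zero coefficients are chosen off the support of \<open>e\<close>; this makes the sums \<open>a i\<close> finite.\<close>
    have "\<exists>f. (\<forall>i<k. f i \<in> coeffs j (n i)) \<and> w j - (\<Sum>i<k. pmult (f i) (z i)) \<in> B j \<and>
        (e j = B j \<longrightarrow> f = (\<lambda>_. 0))" for j
    proof (cases "e j = B j")
      case True
      then have "w j - (\<Sum>i<k. pmult 0 (z i)) \<in> B j"
        using w(2)[of j] coset_eq_subgroup_iff[OF subgroup_B[of j], of "w j"]
        by (simp only: pmult_simps sum.neutral_const diff_0_right)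
      then show ?thesis
        by (intro exI[of _ "\<lambda>_. 0"]) (simp only: zero_coeffs simp_thms)
    next
      case False
      then show ?thesis
        using comb w(1)[of j] by blast
    qed
    then have "\<exists>F. \<forall>j. (\<forall>i<k. F j i \<in> coeffs j (n i)) \<and> w j - (\<Sum>i<k. pmult (F j i) (z i)) \<in> B j \<and>
        (e j = B j \<longrightarrow> F j = (\<lambda>_. 0))"
      by (intro choice allI)
    then obtain F where "\<forall>j. (\<forall>i<k. F j i \<in> coeffs j (n i)) \<and>
        w j - (\<Sum>i<k. pmult (F j i) (z i)) \<in> B j \<and> (e j = B j \<longrightarrow> F j = (\<lambda>_. 0))"
      by (rule exE)
    then have F: "\<And>j i. i < k \<Longrightarrow> F j i \<in> coeffs j (n i)"
        "\<And>j. w j - (\<Sum>i<k. pmult (F j i) (z i)) \<in> B j" "\<And>j. e j = B j \<Longrightarrow> F j = (\<lambda>_. 0)"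
      by simp_all
    define c where "c i m = (if \<exists>j. sh m j = n i then F (THE j. sh m j = n i) i else 0)" for i m
    have c_eq: "c i m = F j i" if "sh m j = n i" for i m j
    proof -
      have "(THE j. sh m j = n i) = j"
        using that by (intro the_equality) (auto intro: inj_sh[of m])
      then show ?thesis
        using that by (auto simp: c_def)
    qed
    have c_inv: "c i m \<in> inv_sym_pow G m" if "i < k" for i m
    proof (cases "\<exists>j. sh m j = n i")
      case True
      then obtain j where j: "sh m j = n i"
        by blast
      have "F j i \<in> inv_sym_pow G m"
      proof (cases "F j i = 0")
        case True
        then show ?thesis
          by (simp add: add_subgroup_zero[OF add_subgroup_inv_sym_pow])
      next
        case False
        then obtain m' where m': "sh m' j = n i" "F j i \<in> inv_sym_pow G m'"
          using F(1)[OF \<open>i < k\<close>, of j] by (auto simp: coeffs_def)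
        then have "m' = m"
          using j by (intro inj_degree[of m' j m]) simp
        then show ?thesis
          using m' by simp
      qed
      then show ?thesis
        using c_eq[of m j i] j by simp
    next
      case False
      then show ?thesis
        by (simp add: c_def add_subgroup_zero[OF add_subgroup_inv_sym_pow])
    qed
    have c_fin: "finite {m. c i m \<noteq> 0}" for i
    proof (rule finite_subset)
      show "{m. c i m \<noteq> 0} \<subseteq> (\<Union>j\<in>{j. e j \<noteq> B j}. {m. sh m j = n i})"
      proof
        fix m assume "m \<in> {m. c i m \<noteq> 0}"
        then have "c i m \<noteq> 0"
          by simp
        then obtain j where j: "sh m j = n i"
          unfolding c_def by meson
        then have "F j i \<noteq> 0"
          using c_eq[of m j i] \<open>c i m \<noteq> 0\<close> by simp
        then have "e j \<noteq> B j"
          using F(3)[of j] by auto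
        then show "m \<in> (\<Union>j\<in>{j. e j \<noteq> B j}. {m. sh m j = n i})"
          using j by blast
      qed
      have "finite {m. sh m j = n i}" for j
      proof (cases "\<exists>m. sh m j = n i")
        case True
        then obtain m where "sh m j = n i"
          by blast
        then have "{m. sh m j = n i} \<subseteq> {m}"
          by (auto intro: inj_degree[of _ j])
        then show ?thesis
          using finite_subset by blast
      qed auto
      then show "finite (\<Union>j\<in>{j. e j \<noteq> B j}. {m. sh m j = n i})"
        using fin by blast
    qed
    define a where "a i = (\<Sum>m | c i m \<noteq> 0. c i m)" for i
    have a: "a i \<in> carrier (inv_polys G)" "hom_part G (a i) = c i" if "i < k" for i
      unfolding a_def using inv_polysI[of "c i" G] c_inv that c_fin by auto
    have comp: "component_at (c i) j (n i) = F j i" if "i < k" for i j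
    proof (cases "\<exists>m. sh m j = n i")
      case True
      then show ?thesis
        using component_at_eq c_eq by metis
    next
      case False
      then show ?thesis
        using F(1)[OF that, of j] by (auto simp: component_at_def coeffs_def)
    qed
    have "e j = (\<Oplus>\<^bsub>quot\<^esub>i\<in>{..<k}. a i \<odot>\<^bsub>quot\<^esub> homog quot (n i) (x i)) j" for j
    proof -
      have "(\<Sum>i<k. pmult (component_at (hom_part G (a i)) j (n i)) (z i)) =
          (\<Sum>i<k. pmult (F j i) (z i))"
        using a(2) comp by (intro sum.cong) auto
      moreover have "e j = (\<Sum>i<k. pmult (F j i) (z i)) +o B j"
        unfolding w(2) using F(2) coset_eq_iff[OF subgroup_B] by blast
      ultimately show ?thesis
        using combination_quot[of k a z n x j] a(1) z x by simp
    qed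
    then show "\<exists>a\<in>{..<k} \<rightarrow> carrier (inv_polys G).
        e = (\<Oplus>\<^bsub>quot\<^esub>i\<in>{..<k}. a i \<odot>\<^bsub>quot\<^esub> homog quot (n i) (x i))"
      using a(1) by (intro bexI[of _ a]) auto
  qed
qed

end


section \<open>The final page\<close>

lemma eventual_value_eqI:
  assumes "\<And>r. r \<ge> R \<Longrightarrow> S r = A"
  shows "eventual_value S = A"
proof -
  have ev: "\<forall>\<^sub>F r in sequentially. S r = A"
    using assms by (auto simp: eventually_sequentially)
  show ?thesis
    unfolding eventual_value_def
  proof (rule the_equality)
    fix A' assume "\<forall>\<^sub>F r in sequentially. S r = A'"
    with ev have "\<forall>\<^sub>F r in sequentially. A' = A"
      by eventually_elim simp
    then show "A' = A"
      by simp
  qed (rule ev)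
qed

text \<open>In total degree \<open>n\<close> the filtration vanishes above \<open>n\<close>, so for large \<open>r\<close> the condition
  \<open>d c \<in> F\<^sup>p\<^sup>+\<^sup>r\<close> means \<open>d c = 0\<close>.\<close>

lemma Zss_limit:
  assumes "r > q + 1"
  shows "Zss G M \<phi> r p q = cocycles G M \<phi> p (p + q)"
  using assms by (simp add: Zss_def cocycles_def FC_above_degree)

text \<open>For large \<open>r\<close> the cochains whose coboundaries are divided out are no longer restricted, since
  \<open>F\<^sup>p\<^sup>-\<^sup>r\<^sup>+\<^sup>1\<close> is everything. What remains is that the coboundaries lie in \<open>F\<^sup>p\<close>.\<close>

lemma Bss_limit:
  assumes "r > p" and "r > q + 1"
  shows "Bss G M \<phi> r p q = cocycles G M \<phi> (p + 1) (p + q) + (BG G M \<phi> (p + q) \<inter> FC G M \<phi> p (p + q))"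
proof -
  have "Zss G M \<phi> (r - 1) (p + 1) (q - 1) = cocycles G M \<phi> (p + 1) (p + q)"
    using assms Zss_limit[of "q - 1" "r - 1" G M \<phi> "p + 1"] by (simp add: algebra_simps)
  moreover have "Zss G M \<phi> (r - 1) (p - r + 1) (q + r - 2) =
      {c \<in> CG G M \<phi> (p + q - 1). dG G M \<phi> c \<in> FC G M \<phi> p (p + q)}"
    using assms FC_nonpos[of "p - r + 1" G M \<phi> "p + q - 1"] by (simp add: Zss_def algebra_simps)
  then have "dG G M \<phi> ` Zss G M \<phi> (r - 1) (p - r + 1) (q + r - 2) =
      BG G M \<phi> (p + q) \<inter> FC G M \<phi> p (p + q)"
    by (auto simp: BG_def)
  ultimately show ?thesis
    by (simp add: Bss_def)
qed

lemma Binf_eq: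
  "Binf G M \<phi> p q = cocycles G M \<phi> (p + 1) (p + q) + (BG G M \<phi> (p + q) \<inter> FC G M \<phi> p (p + q))"
  unfolding Binf_def
  by (rule eventual_value_eqI[of "nat (max p (q + 1)) + 1"], rule Bss_limit) auto

lemma Einf_eq: "Einf G M \<phi> p q = {z +o Binf G M \<phi> p q | z. z \<in> cocycles G M \<phi> p (p + q)}"
  unfolding Einf_def
proof (rule eventual_value_eqI)
  fix r :: nat assume "r \<ge> nat (max p (q + 1)) + 1"
  then have "int r > p" "int r > q + 1"
    by auto
  then show "Ess G M \<phi> (int r) p q = {z +o Binf G M \<phi> p q | z. z \<in> cocycles G M \<phi> p (p + q)}"
    unfolding Ess_def by (simp add: Bss_limit Zss_limit Binf_eq)
qed

lemma add_subgroup_Binf: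
  assumes "smooth_manifold M"
  shows "add_subgroup (Binf G M \<phi> p q)"
proof -
  let ?A = "cocycles G M \<phi> (p + 1) (p + q)" and ?C = "BG G M \<phi> (p + q) \<inter> FC G M \<phi> p (p + q)"
  have A: "add_subgroup ?A"
    by (rule add_subgroup_cocycles[OF assms])
  have C: "add_subgroup ?C"
    using add_subgroup_BG[OF assms, of G \<phi> "p + q"] add_subgroup_FC[of G M \<phi> p "p + q"]
    by (simp add: add_subgroup_def)
  show ?thesis
    unfolding Binf_eq add_subgroup_def
  proof (intro conjI ballI)
    show "0 \<in> ?A + ?C"
      using set_plus_intro[OF add_subgroup_zero[OF A] add_subgroup_zero[OF C]] by simp
    fix x y assume "x \<in> ?A + ?C" "y \<in> ?A + ?C"
    then obtain a c a' c' where "a \<in> ?A" "c \<in> ?C" "a' \<in> ?A" "c' \<in> ?C" and xy: "x = a + c" "y = a' + c'"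
      by (metis set_plus_elim)
    then have "(a - a') + (c - c') \<in> ?A + ?C"
      by (intro set_plus_intro add_subgroup_diff[OF A] add_subgroup_diff[OF C])
    then show "x - y \<in> ?A + ?C"
      by (simp add: xy algebra_simps)
  qed
qed

lemma pmult_Binf:
  assumes "smooth_manifold M" and "f \<in> inv_sym_pow G m" and "b \<in> Binf G M \<phi> p q"
  shows "pmult f b \<in> Binf G M \<phi> (p + 2 * int m) q"
proof -
  obtain w c where b: "b = w + c" and w: "w \<in> cocycles G M \<phi> (p + 1) (p + q)"
      and c: "c \<in> BG G M \<phi> (p + q)" "c \<in> FC G M \<phi> p (p + q)"
    using assms(3) unfolding Binf_eq by (auto elim: set_plus_elim)
  have "pmult f w \<in> cocycles G M \<phi> (p + 2 * int m + 1) (p + 2 * int m + q)"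
    using pmult_cocycles[OF assms(1,2) w] by (simp add: algebra_simps)
  moreover have "pmult f c \<in> BG G M \<phi> (p + 2 * int m + q)"
    using pmult_BG[OF assms(1,2) c(1)] by (simp add: algebra_simps)
  moreover have "pmult f c \<in> FC G M \<phi> (p + 2 * int m) (p + 2 * int m + q)"
    using pmult_FC[OF assms(2) c(2)] by (simp add: algebra_simps)
  ultimately show ?thesis
    unfolding Binf_eq b pmult_add_right by (intro set_plus_intro IntI)
qed


section \<open>Lifting generators\<close>

lemma graded_quotient_HG:
  assumes "smooth_manifold M"
  shows "graded_quotient G (cocycles G M \<phi> 0) (BG G M \<phi>) (\<lambda>m n. n - 2 * int m)"
proof
  fix f m z and i :: int
  assume "f \<in> inv_sym_pow G m" "z \<in> cocycles G M \<phi> 0 (i - 2 * int m)"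
  from pmult_cocycles[OF assms this] show "pmult f z \<in> cocycles G M \<phi> 0 i"
    using cocycles_mono[of 0 "2 * int m" G M \<phi> i] by auto
next
  fix f m b and i :: int
  assume "f \<in> inv_sym_pow G m" "b \<in> BG G M \<phi> (i - 2 * int m)"
  from pmult_BG[OF assms this] show "pmult f b \<in> BG G M \<phi> i"
    by simp
qed (simp_all add: add_subgroup_cocycles[OF assms] add_subgroup_BG[OF assms])

lemma graded_quotient_Einf:
  assumes "smooth_manifold M"
  shows "graded_quotient G (\<lambda>(p, q). cocycles G M \<phi> p (p + q)) (\<lambda>(p, q). Binf G M \<phi> p q)
    (\<lambda>m (p, q). (p - 2 * int m, q))"
proof
  fix f m z and i :: "int \<times> int"
  assume f: "f \<in> inv_sym_pow G m"
    and z: "z \<in> (case case i of (p, q) \<Rightarrow> (p - 2 * int m, q) of (p, q) \<Rightarrow> cocycles G M \<phi> p (p + q))"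
  obtain p q where i: "i = (p, q)"
    by (cases i)
  show "pmult f z \<in> (case i of (p, q) \<Rightarrow> cocycles G M \<phi> p (p + q))"
    using pmult_cocycles[OF assms f, of z \<phi> "p - 2 * int m" "p - 2 * int m + q"] z
    by (simp add: i algebra_simps)
next
  fix f m b and i :: "int \<times> int"
  assume f: "f \<in> inv_sym_pow G m"
    and b: "b \<in> (case case i of (p, q) \<Rightarrow> (p - 2 * int m, q) of (p, q) \<Rightarrow> Binf G M \<phi> p q)"
  obtain p q where i: "i = (p, q)"
    by (cases i)
  show "pmult f b \<in> (case i of (p, q) \<Rightarrow> Binf G M \<phi> p q)"
    using pmult_Binf[OF assms f, of b \<phi> "p - 2 * int m" q] b by (simp add: i)
qed (auto simp: add_subgroup_cocycles[OF assms] add_subgroup_Binf[OF assms] split: prod.splits)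

lemma generates_HG_iff:
  fixes k :: nat
  assumes "smooth_manifold M" and "\<And>i. i < k \<Longrightarrow> z i \<in> cocycles G M \<phi> 0 (n i)"
    and "\<And>i. i < k \<Longrightarrow> y i = z i +o BG G M \<phi> (n i)"
  shows "generates (inv_polys G) (HG_module G M \<phi>) k
      (\<lambda>i. homog (HG_module G M \<phi>) (n i) (y i)) \<longleftrightarrow>
    (\<forall>j. \<forall>c\<in>cocycles G M \<phi> 0 j. \<exists>f.
      (\<forall>i<k. f i \<in> graded_quotient.coeffs G (\<lambda>m n. n - 2 * int m) j (n i)) \<and>
      c - (\<Sum>i<k. pmult (f i) (z i)) \<in> BG G M \<phi> j)"
proof -
  interpret graded_quotient G "cocycles G M \<phi> 0" "BG G M \<phi>" "\<lambda>m n. n - 2 * int m"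
    by (rule graded_quotient_HG[OF assms(1)])
  have "HG G M \<phi> = (\<lambda>i. {z +o BG G M \<phi> i | z. z \<in> cocycles G M \<phi> 0 i})"
    by (simp add: fun_eq_iff HG_def cocycles_def)
  then have "HG_module G M \<phi> = quot"
    by (simp add: HG_module_def quot_def)
  then show ?thesis
    using generates_quot_iff[of k z n y] assms(2,3) by simp
qed

lemma generates_Einf_iff:
  fixes k :: nat
  assumes "smooth_manifold M" and "\<And>i. i < k \<Longrightarrow> z i \<in> cocycles G M \<phi> (p i) (p i + q i)"
    and "\<And>i. i < k \<Longrightarrow> x i = z i +o Binf G M \<phi> (p i) (q i)"
  shows "generates (inv_polys G) (Einf_module G M \<phi>) k
      (\<lambda>i. homog (Einf_module G M \<phi>) (p i, q i) (x i)) \<longleftrightarrow>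
    (\<forall>p' q'. \<forall>c\<in>cocycles G M \<phi> p' (p' + q'). \<exists>f.
      (\<forall>i<k. f i \<in> graded_quotient.coeffs G (\<lambda>m (p, q). (p - 2 * int m, q)) (p', q') (p i, q i)) \<and>
      c - (\<Sum>i<k. pmult (f i) (z i)) \<in> Binf G M \<phi> p' q')"
proof -
  interpret graded_quotient G "\<lambda>(p, q). cocycles G M \<phi> p (p + q)" "\<lambda>(p, q). Binf G M \<phi> p q"
      "\<lambda>m (p, q). (p - 2 * int m, q)"
    by (rule graded_quotient_Einf[OF assms(1)])
  have "(\<lambda>(p, q). Einf G M \<phi> p q) =
      (\<lambda>i. {z +o (case i of (p, q) \<Rightarrow> Binf G M \<phi> p q) | z. z \<in> (case i of (p, q) \<Rightarrow> cocycles G M \<phi> p (p + q))})"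
    by (simp add: fun_eq_iff Einf_eq)
  then have "Einf_module G M \<phi> = quot"
    by (simp add: Einf_module_def quot_def)
  then show ?thesis
    using generates_quot_iff[of k z "\<lambda>i. (p i, q i)" x] assms(2,3) by (simp add: split_paired_All)
qed

text \<open>The hypothesis on \<open>y\<close> says that \<open>y\<close> is the class of some element of the coset \<open>x\<close>. Such an
  element differs from a cocycle in \<open>x\<close> by \<open>w + b\<close> with a cocycle \<open>w\<close> in \<open>F\<^sup>p\<^sup>+\<^sup>1\<close> and a
  coboundary \<open>b\<close>; dropping \<open>b\<close> changes neither class and leaves a cocycle in \<open>F\<^sup>p\<close>.\<close>

lemma common_representative:
  assumes M: "smooth_manifold M" and x: "x \<in> Einf G M \<phi> p q" and y: "y \<in> FH G M \<phi> p (p + q)"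
    and eq: "gr_proj G M \<phi> p (p + q) y = Einf_iso G M \<phi> p q x"
  obtains z where "z \<in> cocycles G M \<phi> p (p + q)" and "x = z +o Binf G M \<phi> p q"
    and "y = z +o BG G M \<phi> (p + q)"
proof -
  let ?B = "BG G M \<phi> (p + q)"
  note B = add_subgroup_BG[OF M, of G \<phi> "p + q"]
  obtain z0 where z0: "z0 \<in> cocycles G M \<phi> p (p + q)" and x_eq: "x = z0 +o Binf G M \<phi> p q"
    using x unfolding Einf_eq by blast
  obtain u where y_eq: "y = u +o ?B"
    using y unfolding FH_def by blast
  have "0 \<in> cocycles G M \<phi> (p + 1) (p + q)"
    by (rule add_subgroup_zero[OF add_subgroup_cocycles[OF M]])
  then have "0 +o ?B \<in> FH G M \<phi> (p + 1) (p + q)"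
    unfolding FH_def cocycles_def by blast
  moreover have "y = y + (0 +o ?B)"
    unfolding y_eq coset_add[OF B] by simp
  ultimately have "y \<in> gr_proj G M \<phi> p (p + q) y"
    unfolding gr_proj_def elt_set_plus_def by blast
  then obtain z' where z': "z' \<in> x" and y_z': "y = z' +o ?B"
    unfolding eq Einf_iso_def by blast
  then have "z' - z0 \<in> Binf G M \<phi> p q"
    by (simp add: x_eq mem_coset_iff)
  then obtain w b where w: "w \<in> cocycles G M \<phi> (p + 1) (p + q)" and b: "b \<in> ?B"
      "b \<in> FC G M \<phi> p (p + q)" and z'_eq: "z' - z0 = w + b"
    unfolding Binf_eq by (auto elim: set_plus_elim)
  have "w + 0 \<in> Binf G M \<phi> p q"
    unfolding Binf_eq using w add_subgroup_zero[OF B] add_subgroup_zero[OF add_subgroup_FC]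
    by (intro set_plus_intro IntI)
  then have "x = (z0 + w) +o Binf G M \<phi> p q"
    unfolding x_eq coset_eq_iff[OF add_subgroup_Binf[OF M]]
    using add_subgroup_diff[OF add_subgroup_Binf[OF M] add_subgroup_zero[OF add_subgroup_Binf[OF M]]]
    by fastforce
  moreover have "z' - (z0 + w) = b"
    using z'_eq by (simp add: algebra_simps)
  then have "y = (z0 + w) +o ?B"
    unfolding y_z' coset_eq_iff[OF B] using b by simp
  moreover have "w \<in> cocycles G M \<phi> p (p + q)"
    using w cocycles_mono[of p "p + 1" G M \<phi> "p + q"] by auto
  then have "z0 + w \<in> cocycles G M \<phi> p (p + q)"
    by (rule add_subgroup_add[OF add_subgroup_cocycles[OF M] z0])
  ultimately show thesis
    using that by blast
qed

text \<open>The core of the argument, an induction on the number \<open>d\<close> of remaining filtration steps. Modulo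
  the boundaries of \<open>E\<^sub>\<infinity>\<close>, a cocycle \<open>c\<close> in \<open>F\<^bsup>p'\<^esup>\<close> is a combination of the \<open>z i\<close>. The error is the
  sum of a coboundary, which is zero in cohomology, and a cocycle in \<open>F\<^bsup>p'+1\<^esup>\<close>, to which the
  induction hypothesis applies. The induction starts above the total degree \<open>n\<close>, where the
  filtration is zero.\<close>

lemma cocycle_combination_by_filtration:
  fixes k :: nat
  assumes M: "smooth_manifold M"
    and Einf: "\<And>p' q' c. c \<in> cocycles G M \<phi> p' (p' + q') \<Longrightarrow> \<exists>f.
      (\<forall>i<k. f i \<in> graded_quotient.coeffs G (\<lambda>m (p, q). (p - 2 * int m, q)) (p', q') (p i, q i)) \<and>
      c - (\<Sum>i<k. pmult (f i) (z i)) \<in> Binf G M \<phi> p' q'"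
    and "c \<in> cocycles G M \<phi> p' n" and "n < p' + int d"
  shows "\<exists>f. (\<forall>i<k. f i \<in> graded_quotient.coeffs G (\<lambda>m n. n - 2 * int m) n (p i + q i)) \<and>
    c - (\<Sum>i<k. pmult (f i) (z i)) \<in> BG G M \<phi> n"
proof -
  interpret H: graded_quotient G "cocycles G M \<phi> 0" "BG G M \<phi>" "\<lambda>m n. n - 2 * int m"
    by (rule graded_quotient_HG[OF M])
  interpret E: graded_quotient G "\<lambda>(p, q). cocycles G M \<phi> p (p + q)" "\<lambda>(p, q). Binf G M \<phi> p q"
      "\<lambda>m (p, q). (p - 2 * int m, q)"
    by (rule graded_quotient_Einf[OF M])
  \<comment> \<open>A polynomial of degree \<open>m\<close> shifts \<open>(p, q)\<close> by \<open>(2m, 0)\<close>, hence the total degree by \<open>2m\<close>.\<close>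
  have coeffs: "E.coeffs (p', q') (a, b) \<subseteq> H.coeffs (p' + q') (a + b)" for p' q' a b
    by (auto simp: E.coeffs_def H.coeffs_def)
  show ?thesis
    using assms(3,4)
  proof (induction d arbitrary: c p')
    case 0
    then have "c = 0"
      by (simp add: cocycles_def FC_above_degree)
    moreover have "0 - (\<Sum>i<k. pmult 0 (z i)) \<in> BG G M \<phi> n"
      by (simp only: pmult_simps sum.neutral_const diff_0_right add_subgroup_zero[OF add_subgroup_BG[OF M]])
    ultimately show ?case
      by (intro exI[of _ "\<lambda>_. 0"] conjI allI impI) (simp_all only: H.zero_coeffs)
  next
    case (Suc d)
    define q' where "q' = n - p'"
    have n: "n = p' + q'"
      by (simp add: q'_def)
    obtain f where f: "\<And>i. i < k \<Longrightarrow> f i \<in> E.coeffs (p', q') (p i, q i)"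
        and "c - (\<Sum>i<k. pmult (f i) (z i)) \<in> Binf G M \<phi> p' q'"
      using Einf[of c p' q'] Suc.prems(1) unfolding n by blast
    then obtain w b where w: "w \<in> cocycles G M \<phi> (p' + 1) n" and b: "b \<in> BG G M \<phi> n"
        and eq: "c - (\<Sum>i<k. pmult (f i) (z i)) = w + b"
      unfolding Binf_eq n by (auto elim: set_plus_elim)
    have "n < p' + 1 + int d"
      using Suc.prems(2) by simp
    from Suc.IH[OF w this] obtain g where g: "\<forall>i<k. g i \<in> H.coeffs n (p i + q i)"
        and wg: "w - (\<Sum>i<k. pmult (g i) (z i)) \<in> BG G M \<phi> n"
      by blast
    have "c - (\<Sum>i<k. pmult (f i + g i) (z i)) = (w - (\<Sum>i<k. pmult (g i) (z i))) + b"
      using eq by (simp add: pmult_add_left sum.distrib algebra_simps)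
    also have "\<dots> \<in> BG G M \<phi> n"
      by (rule add_subgroup_add[OF add_subgroup_BG[OF M] wg b])
    finally have "c - (\<Sum>i<k. pmult (f i + g i) (z i)) \<in> BG G M \<phi> n" .
    moreover have "f i + g i \<in> H.coeffs n (p i + q i)" if "i < k" for i
      using subsetD[OF coeffs f[OF that]] g that unfolding n by (intro H.coeffs_add) auto
    ultimately show ?case
      by (intro exI[of _ "\<lambda>i. f i + g i"]) blast
  qed
qed

theorem lemmaA17:
  fixes G :: "'g lie_group" and M :: "'m mfd" and \<phi> :: "'g \<Rightarrow> 'm \<Rightarrow> 'm"
    and k :: nat and p q :: "nat \<Rightarrow> int" and x y :: "nat \<Rightarrow> ('g, 'm) cochain set"
  assumes "lie_group G"
    and "compact_space (mtop (gmfd G))"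
    and "connected_space (mtop (gmfd G))"
    and "smooth_manifold M"
    and "smooth_action G M \<phi>"
    and "\<And>i. i < k \<Longrightarrow> x i \<in> Einf G M \<phi> (p i) (q i)"
    and "generates (inv_polys G) (Einf_module G M \<phi>) k
           (\<lambda>i. homog (Einf_module G M \<phi>) (p i, q i) (x i))"
    and "\<And>i. i < k \<Longrightarrow> y i \<in> FH G M \<phi> (p i) (p i + q i)"
    and "\<And>i. i < k \<Longrightarrow>
           gr_proj G M \<phi> (p i) (p i + q i) (y i) = Einf_iso G M \<phi> (p i) (q i) (x i)"
  shows "generates (inv_polys G) (HG_module G M \<phi>) k
           (\<lambda>i. homog (HG_module G M \<phi>) (p i + q i) (y i))"
proof -
  note M = \<open>smooth_manifold M\<close>
  have "\<exists>z. z \<in> cocycles G M \<phi> (p i) (p i + q i) \<and> x i = z +o Binf G M \<phi> (p i) (q i) \<and>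
      y i = z +o BG G M \<phi> (p i + q i)" if "i < k" for i
    using common_representative[OF M assms(6,8,9)[OF that]] by metis
  then obtain z where z: "\<And>i. i < k \<Longrightarrow> z i \<in> cocycles G M \<phi> (p i) (p i + q i)"
      and x: "\<And>i. i < k \<Longrightarrow> x i = z i +o Binf G M \<phi> (p i) (q i)"
      and y: "\<And>i. i < k \<Longrightarrow> y i = z i +o BG G M \<phi> (p i + q i)"
    by metis
  have Einf: "\<forall>p' q'. \<forall>c\<in>cocycles G M \<phi> p' (p' + q'). \<exists>f.
      (\<forall>i<k. f i \<in> graded_quotient.coeffs G (\<lambda>m (p, q). (p - 2 * int m, q)) (p', q') (p i, q i)) \<and>
      c - (\<Sum>i<k. pmult (f i) (z i)) \<in> Binf G M \<phi> p' q'"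
    by (rule iffD1[OF generates_Einf_iff[OF M, where z = z and x = x]]) (simp_all only: z x assms(7))
  have z0: "z i \<in> cocycles G M \<phi> 0 (p i + q i)" if "i < k" for i
    using z[OF that] FC_subset_CG by (fastforce simp: cocycles_def)
  have "\<forall>n. \<forall>c\<in>cocycles G M \<phi> 0 n. \<exists>f.
      (\<forall>i<k. f i \<in> graded_quotient.coeffs G (\<lambda>m n. n - 2 * int m) n (p i + q i)) \<and>
      c - (\<Sum>i<k. pmult (f i) (z i)) \<in> BG G M \<phi> n"
  proof (intro allI ballI)
    fix n c assume "c \<in> cocycles G M \<phi> 0 n"
    then show "\<exists>f. (\<forall>i<k. f i \<in> graded_quotient.coeffs G (\<lambda>m n. n - 2 * int m) n (p i + q i)) \<and>
        c - (\<Sum>i<k. pmult (f i) (z i)) \<in> BG G M \<phi> n"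
      \<comment> \<open>\<open>F\<^sup>0\<close> is reached from above degree \<open>n\<close> in \<open>n + 1\<close> steps.\<close>
      using Einf by (intro cocycle_combination_by_filtration[OF M, where d = "nat (n + 1)"]) auto
  qed
  then show ?thesis
    by (intro iffD2[OF generates_HG_iff[OF M, where z = z]]) (simp_all only: z0 y)
qed

end
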